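(* For $K$ and $j$ sufficiently large (i.e. there exist $K_0, j_0<\infty$ such that for all $K\ge K_0$ and $j\ge j_0$), $$\mathbb{P}\left(\exists\, \tau\in[0,1] \text{ such that } |S_0^{\tau}(t)|\le j+K\sqrt{t}\ \text{ for all } t\ge 0\right)>0 .$$
   Context: Dynamical discrete web (DyDW): let $\mathbb{Z}^2_{\mathrm{even}}=\{(x,t)\in\mathbb{Z}^2: x+t \text{ even}\}$, where $x$ is space and $t$ is (random walk) time. To each $z\in\mathbb{Z}^2_{\mathrm{even}}$ assign, independently over $z$, a right-continuous process $(\xi_z^\tau)_{\tau\ge 0}$ with values in $\{-1,+1\}$: $\xi_z^0$ is uniform on $\{\pm1\}$, and at each ring of a rate one Poisson clock attached to $z$ the value is replaced by a fresh independent uniform $\pm1$ variable (which may agree with the old value). All clocks, initial values and resampled values are independent. The parameter $\tau$ is called dynamical time. For fixed $\tau$, draw an arrow from each $(x,t)\in\mathbb{Z}^2_{\mathrm{even}}$ to $(x+\xi_{(x,t)}^\tau,t+1)$; $S_{z}^{\tau}(\cdot)$ denotes the path that starts at $z$ and follows the arrows at dynamical time $\tau$ (linearly interpolated between integer times). $S_0^\tau:=S_{(0,0)}^\tau$ is the path from the origin. *)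

theory Defs
  imports "HOL-Probability.Probability"
begin

definition Z2_even :: "(int \<times> int) set" where
  "Z2_even = {(x, t). even (x + t)}"

text \<open>
  The Poisson clock at the site \<open>z\<close> is given by its i.i.d. exponential waiting times
  \<open>gap z 0, gap z 1, \<dots>\<close>; \<open>val z 0\<close> is the initial value at \<open>z\<close> and \<open>val z (Suc n)\<close>
  is the fresh value drawn at the ring number \<open>n\<close> (counting from 0).
\<close>

locale dynamical_discrete_web = prob_space M
  for M :: "'a measure"
    and gap :: "int \<times> int \<Rightarrow> nat \<Rightarrow> 'a \<Rightarrow> real"
    and val :: "int \<times> int \<Rightarrow> nat \<Rightarrow> 'a \<Rightarrow> int" +
  assumes gap_exponential:
      "\<And>z n. z \<in> Z2_even \<Longrightarrow> distributed M lborel (gap z n) (exponential_density 1)"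
    and val_measurable:
      "\<And>z n. z \<in> Z2_even \<Longrightarrow> val z n \<in> M \<rightarrow>\<^sub>M count_space {-1, 1}"
    and val_uniform:
      "\<And>z n. z \<in> Z2_even \<Longrightarrow>
        distr M (count_space {-1, 1}) (val z n) = uniform_count_measure {-1, 1}"
    and all_independent:
      "indep_vars (\<lambda>_. borel)
        (\<lambda>i. case i of Inl (z, n) \<Rightarrow> gap z n | Inr (z, n) \<Rightarrow> (\<lambda>\<omega>. real_of_int (val z n \<omega>)))
        ((Z2_even \<times> (UNIV :: nat set)) <+> (Z2_even \<times> (UNIV :: nat set)))"

definition ring_time :: "(int \<times> int \<Rightarrow> nat \<Rightarrow> 'a \<Rightarrow> real) \<Rightarrow> int \<times> int \<Rightarrow> nat \<Rightarrow> 'a \<Rightarrow> real" where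
  "ring_time gap z n \<omega> = (\<Sum>i\<le>n. gap z i \<omega>)"

text \<open>
  Almost surely only finitely many rings occur up to any time \<open>\<tau>\<close>, so the cardinality
  below is the Poisson counting process, up to a null event. Rings at time \<open>\<tau>\<close>
  itself are counted, which makes \<open>arrow\<close> right-continuous in \<open>\<tau>\<close>.
\<close>

definition num_rings :: "(int \<times> int \<Rightarrow> nat \<Rightarrow> 'a \<Rightarrow> real) \<Rightarrow> int \<times> int \<Rightarrow> real \<Rightarrow> 'a \<Rightarrow> nat" where
  "num_rings gap z \<tau> \<omega> = card {n. ring_time gap z n \<omega> \<le> \<tau>}"

definition arrow ::
  "(int \<times> int \<Rightarrow> nat \<Rightarrow> 'a \<Rightarrow> real) \<Rightarrow> (int \<times> int \<Rightarrow> nat \<Rightarrow> 'a \<Rightarrow> int)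
    \<Rightarrow> int \<times> int \<Rightarrow> real \<Rightarrow> 'a \<Rightarrow> int" where
  "arrow gap val z \<tau> \<omega> = val z (num_rings gap z \<tau> \<omega>) \<omega>"

text \<open>In the next two definitions \<open>\<xi>\<close> is one frozen arrow configuration, i.e.
  \<open>\<lambda>z. arrow gap val z \<tau> \<omega>\<close>.\<close>

primrec path_steps :: "(int \<times> int \<Rightarrow> int) \<Rightarrow> int \<times> int \<Rightarrow> nat \<Rightarrow> int" where
  "path_steps \<xi> z 0 = fst z"
| "path_steps \<xi> z (Suc n) = path_steps \<xi> z n + \<xi> (path_steps \<xi> z n, snd z + int n)"

text \<open>Linear interpolation; meaningful for times \<open>t \<ge> snd z\<close>.\<close>

definition arrow_path :: "(int \<times> int \<Rightarrow> int) \<Rightarrow> int \<times> int \<Rightarrow> real \<Rightarrow> real" where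
  "arrow_path \<xi> z t =
    (let s = t - real_of_int (snd z); n = nat \<lfloor>s\<rfloor> in
      real_of_int (path_steps \<xi> z n)
        + (s - real n) * real_of_int (path_steps \<xi> z (Suc n) - path_steps \<xi> z n))"

definition dydw_path ::
  "(int \<times> int \<Rightarrow> nat \<Rightarrow> 'a \<Rightarrow> real) \<Rightarrow> (int \<times> int \<Rightarrow> nat \<Rightarrow> 'a \<Rightarrow> int)
    \<Rightarrow> int \<times> int \<Rightarrow> real \<Rightarrow> 'a \<Rightarrow> real \<Rightarrow> real" where
  "dydw_path gap val z \<tau> \<omega> = arrow_path (\<lambda>y. arrow gap val y \<tau> \<omega>) z"

end

theory Submission imports Defs begin

text \<open>
  Second moment method. The path up to time \<open>n\<close> is cut into blocks of length \<open>64 ^ k\<close>, and each block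
  carries a Lipschitz cutoff that vanishes unless the path moves by less than \<open>3 * 8 ^ k\<close> in
  the block; where all cutoffs are positive the path stays below \<open>4 + 32 * sqrt t\<close>. The paths at
  two dynamical times at distance \<open>\<theta>\<close> move independently unless they are at the same site, where
  their steps agree with probability at most \<open>1 - c * \<theta>\<close>. By Tanaka's formula for their difference they spend
  on average at most \<open>C * sqrt T / \<theta>\<close> of the time \<open>T\<close> together, so they can be coupled to
  independent walks with a martingale error of variance \<open>C * sqrt T / \<theta>\<close>, which is negligible against \<open>T\<close> for blocks with
  \<open>8 ^ k * \<theta> > 1\<close>. Each shorter block costs a factor at most 2 in the correlation, so that the
  correlations are bounded by \<open>C / sqrt \<theta>\<close>, uniformly in the number of blocks, and this is integrable.
\<close>

subsection \<open>Averages over walks and coupled pairs of walks\<close>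

text \<open>The averages are finite recursions over the first step, from arbitrary starting points,
  so that optional stopping, maximal inequalities and Tanaka's formula become inductions on the
  number of steps; probability enters only when the averages are identified with expectations under
  the web. Bounds uniform in the starting points let blocks be peeled off one by one although the
  two walks are dependent. The coupling preserves a path only up to a small discrepancy, which is
  why a block carries a Lipschitz cutoff and not an indicator. The moment bound gives, for each
  \<open>n\<close>, a dynamical time that is good up to \<open>n\<close>, with probability bounded
  below uniformly in \<open>n\<close>. The remaining obstacle is the limit in \<open>n\<close>:
  arrows are only right-continuous in \<tau>, so the set of good times need not be closed and
  compactness of [0,1] does not suffice. Hence the second ingredient, that a simple random walk
  almost surely leaves every parabola.\<close>

primrec walk_avg :: "nat \<Rightarrow> (int list \<Rightarrow> real) \<Rightarrow> real" where
  "walk_avg 0 F = F []"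
| "walk_avg (Suc n) F = (walk_avg n (\<lambda>as. F (1 # as)) + walk_avg n (\<lambda>as. F (-1 # as))) / 2"

text \<open>\<open>r x\<close> stands for the chance that the site shows the same draw at both
  dynamical times. A shared fair draw gives weight 1/2 to \<open>a = b\<close>, two separate draws
  give 1/4 to each pair, and the mixture \<open>r / 2 * of_bool (a = b) + (1 - r) / 4\<close> equals
  \<open>(1 + r * a * b) / 4\<close>.\<close>

definition pair_weight :: "(int \<Rightarrow> real) \<Rightarrow> int \<Rightarrow> int \<Rightarrow> int \<Rightarrow> int \<Rightarrow> real" where
  "pair_weight r x y a b = (if x = y then (1 + r x * real_of_int (a * b)) / 4 else 1 / 4)"

primrec pair_avg :: "nat \<Rightarrow> (nat \<Rightarrow> int \<Rightarrow> real) \<Rightarrow> nat \<Rightarrow> int \<Rightarrow> int \<Rightarrow>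
    (int list \<Rightarrow> int list \<Rightarrow> real) \<Rightarrow> real" where
  "pair_avg 0 R t x y F = F [] []"
| "pair_avg (Suc n) R t x y F = (\<Sum>a\<in>{-1,1}. \<Sum>b\<in>{-1,1}. pair_weight (R t) x y a b *
     pair_avg n R (Suc t) (x + a) (y + b) (\<lambda>as bs. F (a # as) (b # bs)))"

text \<open>The third walk copies the second one while the first two are apart, and takes fresh steps while
  they are together; this makes it independent of the first walk.\<close>

definition coupled_weight :: "(int \<Rightarrow> real) \<Rightarrow> int \<Rightarrow> int \<Rightarrow> int \<Rightarrow> int \<Rightarrow> int \<Rightarrow> real" where
  "coupled_weight r x y a b c = (if x = y then (1 + r x * real_of_int (a * b)) / 8
     else if b = c then 1 / 4 else 0)"

primrec coupled_avg :: "nat \<Rightarrow> (nat \<Rightarrow> int \<Rightarrow> real) \<Rightarrow> nat \<Rightarrow> int \<Rightarrow> int \<Rightarrow>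
    (int list \<Rightarrow> int list \<Rightarrow> int list \<Rightarrow> real) \<Rightarrow> real" where
  "coupled_avg 0 R t x y F = F [] [] []"
| "coupled_avg (Suc n) R t x y F = (\<Sum>a\<in>{-1,1}. \<Sum>b\<in>{-1,1}. \<Sum>c\<in>{-1,1}.
     coupled_weight (R t) x y a b c *
     coupled_avg n R (Suc t) (x + a) (y + b) (\<lambda>as bs cs. F (a # as) (b # bs) (c # cs)))"

fun path_max :: "int \<Rightarrow> int list \<Rightarrow> real" where
  "path_max x [] = \<bar>real_of_int x\<bar>"
| "path_max x (a # as) = max \<bar>real_of_int x\<bar> (path_max (x + a) as)"

text \<open>\<open>d\<close> is the current discrepancy between the second and the third walk of the
  coupling. Where it is used the lists have equal length, so that the last equation only ends the
  recursion.\<close>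

fun diff_max :: "int \<Rightarrow> int list \<Rightarrow> int list \<Rightarrow> real" where
  "diff_max d (b # bs) (c # cs) = max \<bar>real_of_int d\<bar> (diff_max (d + b - c) bs cs)"
| "diff_max d _ _ = \<bar>real_of_int d\<bar>"

section \<open>Linearity, moments, maximal inequality and marginals of the averages\<close>

lemma walk_avg_mono:
  assumes "\<And>as. length as = n \<Longrightarrow> set as \<subseteq> {-1,1} \<Longrightarrow> F as \<le> G as"
  shows "walk_avg n F \<le> walk_avg n G"
  using assms
proof (induction n arbitrary: F G)
  case (Suc n)
  have "walk_avg n (\<lambda>as. F (a # as)) \<le> walk_avg n (\<lambda>as. G (a # as))" if "a \<in> {-1,1}" for a
    by (rule Suc.IH) (use Suc.prems that in auto)
  from this[of 1] this[of "-1"] show ?case by (simp add: add_mono)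
qed simp

lemma walk_avg_cong:
  assumes "\<And>as. length as = n \<Longrightarrow> set as \<subseteq> {-1,1} \<Longrightarrow> F as = G as"
  shows "walk_avg n F = walk_avg n G"
  by (intro antisym walk_avg_mono) (use assms in auto)

lemma walk_avg_const [simp]: "walk_avg n (\<lambda>_. c) = c"
  by (induction n) auto

lemma walk_avg_add: "walk_avg n (\<lambda>as. F as + G as) = walk_avg n F + walk_avg n G"
  by (induction n arbitrary: F G) (auto simp: field_simps)

lemma walk_avg_cmult: "walk_avg n (\<lambda>as. c * F as) = c * walk_avg n F"
  by (induction n arbitrary: F) (auto simp: field_simps)

lemma walk_avg_append:
  "walk_avg (n + m) F = walk_avg n (\<lambda>as. walk_avg m (\<lambda>bs. F (as @ bs)))"
  by (induction n arbitrary: F) auto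

lemma walk_avg_uminus: "walk_avg n (\<lambda>as. F (map uminus as)) = walk_avg n F"
proof (induction n arbitrary: F)
  case (Suc n)
  from Suc.IH[of "\<lambda>as. F (1 # as)"] Suc.IH[of "\<lambda>as. F (-1 # as)"] show ?case by simp
qed simp

lemma finite_step_lists: "finite {as. length as = n \<and> set as \<subseteq> {-1,1 :: int}}"
  using finite_lists_length_eq[of "{-1,1::int}" n] by (simp add: conj_commute)

lemma sum_step_lists_Suc:
  "(\<Sum>as | length as = Suc n \<and> set as \<subseteq> {-1,1}. F as) =
    (\<Sum>a\<in>{-1,1}. \<Sum>as | length as = n \<and> set as \<subseteq> {-1,1 :: int}. F (a # as) :: real)"
proof -
  let ?L = "\<lambda>n. {as :: int list. length as = n \<and> set as \<subseteq> {-1,1}}"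
  have "?L (Suc n) = (#) 1 ` ?L n \<union> (#) (-1) ` ?L n"
    by (auto simp: length_Suc_conv)
  then have "sum F (?L (Suc n)) = sum F ((#) 1 ` ?L n \<union> (#) (-1) ` ?L n)" by simp
  also have "\<dots> = sum F ((#) 1 ` ?L n) + sum F ((#) (-1) ` ?L n)"
    using finite_step_lists[of n] by (intro sum.union_disjoint) auto
  finally show ?thesis by (simp add: sum.reindex)
qed

lemma walk_avg_eq_sum:
  "walk_avg n F = (\<Sum>as | length as = n \<and> set as \<subseteq> {-1,1}. F as) / 2 ^ n"
proof (induction n arbitrary: F)
  case 0
  have "{as :: int list. length as = 0 \<and> set as \<subseteq> {-1,1}} = {[]}" by auto
  then show ?case by simp
next
  case (Suc n)
  then show ?case by (simp add: sum_step_lists_Suc add_divide_distrib)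
qed

lemma walk_avg_square: "walk_avg n (\<lambda>as. (x + real_of_int (sum_list as))\<^sup>2) = x\<^sup>2 + n"
proof (induction n arbitrary: x)
  case (Suc n)
  from Suc.IH[of "x + 1"] Suc.IH[of "x - 1"] show ?case
    by (simp add: algebra_simps power2_eq_square)
qed simp

text \<open>For \<open>x = 0\<close> the exact value is \<open>3 * n^2 - 2 * n\<close>; dropping the
  linear term leaves a slack of 2 in each induction step.\<close>

lemma walk_avg_fourth:
  "walk_avg n (\<lambda>as. (x + real_of_int (sum_list as)) ^ 4) \<le> x ^ 4 + 6 * real n * x\<^sup>2 + 3 * (real n)\<^sup>2"
proof (induction n arbitrary: x)
  case (Suc n)
  have "walk_avg (Suc n) (\<lambda>as. (x + real_of_int (sum_list as)) ^ 4)
    = (walk_avg n (\<lambda>as. ((x + 1) + real_of_int (sum_list as)) ^ 4)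
      + walk_avg n (\<lambda>as. ((x - 1) + real_of_int (sum_list as)) ^ 4)) / 2"
    by (simp add: algebra_simps)
  also have "\<dots> \<le> (((x + 1) ^ 4 + 6 * real n * (x + 1)\<^sup>2 + 3 * (real n)\<^sup>2) +
     ((x - 1) ^ 4 + 6 * real n * (x - 1)\<^sup>2 + 3 * (real n)\<^sup>2)) / 2"
    by (intro divide_right_mono add_mono Suc.IH) auto
  also have "\<dots> \<le> x ^ 4 + 6 * real (Suc n) * x\<^sup>2 + 3 * (real (Suc n))\<^sup>2"
    by (simp add: algebra_simps power2_eq_square power4_eq_xxxx)
  finally show ?case .
qed simp

lemma path_max_take: "\<bar>real_of_int (x + sum_list (take i as))\<bar> \<le> path_max x as"
proof (induction as arbitrary: x i)
  case (Cons a as)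
  show ?case
  proof (cases i)
    case (Suc k)
    with Cons[of "x + a" k] show ?thesis by (simp add: add.assoc max.coboundedI2)
  qed simp
qed simp

text \<open>Kolmogorov's inequality. The bound is preserved by averaging over one step and is at
  least 1 once the walk has reached level \<open>l\<close>, so induction on the first step replaces
  a stopping time.\<close>

lemma walk_avg_path_max:
  assumes "l > 0"
  shows "walk_avg n (\<lambda>as. of_bool (path_max x as \<ge> l)) \<le> ((real_of_int x)\<^sup>2 + n) / l\<^sup>2"
proof (induction n arbitrary: x)
  case 0
  show ?case using assms by (auto simp: abs_le_square_iff[symmetric])
next
  case (Suc n)
  show ?case
  proof (cases "\<bar>real_of_int x\<bar> \<ge> l")
    case True
    then have "l\<^sup>2 \<le> (real_of_int x)\<^sup>2"
      using assms power_mono[of l "\<bar>real_of_int x\<bar>" 2] by simp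
    then have "1 \<le> ((real_of_int x)\<^sup>2 + Suc n) / l\<^sup>2" using assms by simp
    moreover have "walk_avg (Suc n) (\<lambda>as. of_bool (path_max x as \<ge> l)) \<le> walk_avg (Suc n) (\<lambda>as. 1)"
      by (rule walk_avg_mono) auto
    ultimately show ?thesis by (metis order_trans walk_avg_const)
  next
    case False
    have "walk_avg (Suc n) (\<lambda>as. of_bool (path_max x as \<ge> l)) =
      (walk_avg n (\<lambda>as. of_bool (path_max (x + 1) as \<ge> l)) +
       walk_avg n (\<lambda>as. of_bool (path_max (x - 1) as \<ge> l))) / 2"
      using False by (simp add: le_max_iff_disj)
    also have "\<dots> \<le> (((real_of_int (x + 1))\<^sup>2 + n) / l\<^sup>2 + ((real_of_int (x - 1))\<^sup>2 + n) / l\<^sup>2) / 2"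
      by (intro divide_right_mono add_mono Suc.IH) auto
    also have "\<dots> = ((real_of_int x)\<^sup>2 + Suc n) / l\<^sup>2"
      using assms by (simp add: field_simps power2_eq_square)
    finally show ?thesis .
  qed
qed

text \<open>The running maximum is 1-Lipschitz in the uniform distance of paths, so a small coupling
  discrepancy changes it little.\<close>

lemma path_max_diff:
  "length bs = length cs \<Longrightarrow> \<bar>path_max x bs - path_max y cs\<bar> \<le> diff_max (x - y) bs cs"
proof (induction bs cs arbitrary: x y rule: list_induct2)
  case (Cons b bs c cs)
  from Cons.IH[of "x + b" "y + c"]
  have "\<bar>path_max (x + b) bs - path_max (y + c) cs\<bar> \<le> diff_max (x - y + b - c) bs cs"
    by (simp add: algebra_simps)
  moreover have "\<bar>max p p' - max q q'\<bar> \<le> max \<bar>p - q\<bar> \<bar>p' - q'\<bar>" for p p' q q' :: real by linarith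
  moreover have "\<bar>\<bar>real_of_int x\<bar> - \<bar>real_of_int y\<bar>\<bar> \<le> \<bar>real_of_int (x - y)\<bar>" by simp
  ultimately show ?case by (simp only: path_max.simps diff_max.simps) (smt (verit))
qed simp

lemma pair_weight_nonneg:
  "0 \<le> r x \<Longrightarrow> r x \<le> 1 \<Longrightarrow> a \<in> {-1,1} \<Longrightarrow> b \<in> {-1,1} \<Longrightarrow> 0 \<le> pair_weight r x y a b"
  by (auto simp: pair_weight_def)

lemma coupled_weight_nonneg:
  "0 \<le> r x \<Longrightarrow> r x \<le> 1 \<Longrightarrow> a \<in> {-1,1} \<Longrightarrow> b \<in> {-1,1} \<Longrightarrow> 0 \<le> coupled_weight r x y a b c"
  by (auto simp: coupled_weight_def)

lemma pair_avg_mono: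
  assumes "\<And>t x. 0 \<le> R t x" "\<And>t x. R t x \<le> 1"
  assumes "\<And>as bs. length as = n \<Longrightarrow> length bs = n \<Longrightarrow> F as bs \<le> G as bs"
  shows "pair_avg n R t x y F \<le> pair_avg n R t x y G"
  using assms(3)
proof (induction n arbitrary: F G t x y)
  case (Suc n)
  show ?case unfolding pair_avg.simps
    by (intro sum_mono mult_left_mono Suc.IH pair_weight_nonneg assms Suc.prems) auto
qed simp

lemma coupled_avg_mono:
  assumes "\<And>t x. 0 \<le> R t x" "\<And>t x. R t x \<le> 1"
  assumes "\<And>as bs cs. length as = n \<Longrightarrow> length bs = n \<Longrightarrow> length cs = n \<Longrightarrow> F as bs cs \<le> G as bs cs"
  shows "coupled_avg n R t x y F \<le> coupled_avg n R t x y G"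
  using assms(3)
proof (induction n arbitrary: F G t x y)
  case (Suc n)
  show ?case unfolding coupled_avg.simps
    by (intro sum_mono mult_left_mono Suc.IH coupled_weight_nonneg assms Suc.prems) auto
qed simp

lemma pair_avg_cmult: "pair_avg n R t x y (\<lambda>as bs. c * F as bs) = c * pair_avg n R t x y F"
  by (induction n arbitrary: F t x y) (auto simp: algebra_simps)

lemma coupled_avg_add:
  "coupled_avg n R t x y (\<lambda>as bs cs. F as bs cs + G as bs cs) =
    coupled_avg n R t x y F + coupled_avg n R t x y G"
  by (induction n arbitrary: F G t x y) (auto simp: algebra_simps)

lemma coupled_avg_cmult:
  "coupled_avg n R t x y (\<lambda>as bs cs. k * F as bs cs) = k * coupled_avg n R t x y F"
  by (induction n arbitrary: F t x y) (auto simp: algebra_simps)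

lemma coupled_avg_const [simp]: "coupled_avg n R t x y (\<lambda>_ _ _. k) = k"
  by (induction n arbitrary: t x y) (auto simp: coupled_weight_def field_simps)

lemma pair_avg_append:
  "pair_avg (n + m) R t x y F = pair_avg n R t x y (\<lambda>as bs.
     pair_avg m R (t + n) (x + sum_list as) (y + sum_list bs) (\<lambda>as' bs'. F (as @ as') (bs @ bs')))"
  by (induction n arbitrary: F t x y) (auto simp: add.assoc)

lemma pair_avg_fst: "pair_avg n R t x y (\<lambda>as bs. F as) = walk_avg n F"
proof (induction n arbitrary: F t x y)
  case (Suc n)
  then show ?case by (simp add: pair_weight_def field_simps)
qed simp

lemma coupled_avg_pair:
  "coupled_avg n R t x y (\<lambda>as bs cs. F as bs) = pair_avg n R t x y F"
proof (induction n arbitrary: F t x y)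
  case (Suc n)
  then show ?case by (auto simp add: pair_weight_def coupled_weight_def field_simps)
qed simp

text \<open>Summing \<open>coupled_weight\<close> over \<open>b\<close> leaves 1/4 for every pair
  \<open>(a, c)\<close>, whether the first two walks are together or apart. So the second walk
  decides how \<open>c\<close> is produced, but not its law given \<open>a\<close>.\<close>

lemma coupled_avg_indep:
  "coupled_avg n R t x y (\<lambda>as bs cs. F as cs) = walk_avg n (\<lambda>as. walk_avg n (F as))"
proof (induction n arbitrary: F t x y)
  case (Suc n)
  have half: "walk_avg n (\<lambda>as. (G as + H as) / 2) = (walk_avg n G + walk_avg n H) / 2" for G H
    using walk_avg_cmult[of n "1/2" "\<lambda>as. G as + H as"] by (simp add: walk_avg_add)
  show ?case by (auto simp add: coupled_weight_def half Suc.IH field_simps)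
qed simp

subsection \<open>Decorrelation of the walks at two dynamical times\<close>

text \<open>The discrepancy is a martingale, so its square is a submartingale. This serves the case
  of the maximal inequality in which the level has already been reached.\<close>

lemma coupled_avg_square_ge:
  assumes R: "\<And>t x. 0 \<le> R t x" "\<And>t x. R t x \<le> 1"
  shows "d\<^sup>2 \<le> coupled_avg n R t x y (\<lambda>as bs cs. (d + real_of_int (sum_list bs) - real_of_int (sum_list cs))\<^sup>2)"
proof (induction n arbitrary: t x y d)
  case (Suc n)
  have "d\<^sup>2 \<le> (\<Sum>a\<in>{-1,1}. \<Sum>b\<in>{-1,1}. \<Sum>c\<in>{-1,1}.
      coupled_weight (R t) x y a b c * (d + real_of_int b - real_of_int c)\<^sup>2)"
    by (simp add: coupled_weight_def field_simps power2_eq_square)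
  also have "\<dots> \<le> coupled_avg (Suc n) R t x y
      (\<lambda>as bs cs. (d + real_of_int (sum_list bs) - real_of_int (sum_list cs))\<^sup>2)"
    unfolding coupled_avg.simps
  proof (intro sum_mono mult_left_mono coupled_weight_nonneg R)
    fix a b c
    show "(d + real_of_int b - real_of_int c)\<^sup>2 \<le> coupled_avg n R (Suc t) (x + a) (y + b)
      (\<lambda>as bs cs. (d + real_of_int (sum_list (b # bs)) - real_of_int (sum_list (c # cs)))\<^sup>2)"
      using Suc.IH[of "d + real_of_int b - real_of_int c" "Suc t" "x + a" "y + b"]
      by (simp add: algebra_simps)
  qed auto
  finally show ?case .
qed simp

text \<open>Doob's inequality for the discrepancy martingale, again by induction on the first
  step.\<close>

lemma coupled_avg_diff_max:
  assumes R: "\<And>t x. 0 \<le> R t x" "\<And>t x. R t x \<le> 1" and "l > 0"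
  shows "coupled_avg n R t x y (\<lambda>as bs cs. of_bool (diff_max d bs cs \<ge> l)) \<le>
    coupled_avg n R t x y (\<lambda>as bs cs. (real_of_int d + real_of_int (sum_list bs) - real_of_int (sum_list cs))\<^sup>2) / l\<^sup>2"
proof (induction n arbitrary: t x y d)
  case 0
  show ?case using assms by (auto simp: abs_le_square_iff[symmetric])
next
  case (Suc n)
  show ?case
  proof (cases "\<bar>real_of_int d\<bar> \<ge> l")
    case True
    then have "l\<^sup>2 \<le> (real_of_int d)\<^sup>2"
      using assms power_mono[of l "\<bar>real_of_int d\<bar>" 2] by simp
    also have "\<dots> \<le> coupled_avg (Suc n) R t x y
        (\<lambda>as bs cs. (real_of_int d + real_of_int (sum_list bs) - real_of_int (sum_list cs))\<^sup>2)"
      by (rule coupled_avg_square_ge[OF R])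
    finally have "1 \<le> coupled_avg (Suc n) R t x y
        (\<lambda>as bs cs. (real_of_int d + real_of_int (sum_list bs) - real_of_int (sum_list cs))\<^sup>2) / l\<^sup>2"
      using \<open>l > 0\<close> by simp
    moreover have "coupled_avg (Suc n) R t x y (\<lambda>as bs cs. of_bool (diff_max d bs cs \<ge> l)) \<le>
        coupled_avg (Suc n) R t x y (\<lambda>_ _ _. 1)"
      by (rule coupled_avg_mono[OF R]) auto
    ultimately show ?thesis unfolding coupled_avg_const by (rule order_trans[rotated])
  next
    case False
    let ?Q = "\<lambda>d bs cs. (real_of_int d + real_of_int (sum_list bs) - real_of_int (sum_list cs))\<^sup>2"
    have "coupled_avg (Suc n) R t x y (\<lambda>as bs cs. of_bool (diff_max d bs cs \<ge> l)) \<le>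
       (\<Sum>a\<in>{-1,1}. \<Sum>b\<in>{-1,1}. \<Sum>c\<in>{-1,1}. coupled_weight (R t) x y a b c *
         (coupled_avg n R (Suc t) (x + a) (y + b) (\<lambda>as bs cs. ?Q (d + b - c) bs cs) / l\<^sup>2))"
      unfolding coupled_avg.simps
    proof ((rule sum_mono)+, rule mult_left_mono, goal_cases)
      case (1 a b c)
      show "coupled_avg n R (Suc t) (x + a) (y + b)
          (\<lambda>as bs cs. of_bool (diff_max d (b # bs) (c # cs) \<ge> l)) \<le>
        coupled_avg n R (Suc t) (x + a) (y + b) (\<lambda>as bs cs. ?Q (d + b - c) bs cs) / l\<^sup>2"
        using False Suc.IH[of "Suc t" "x + a" "y + b" "d + b - c"] by (simp add: le_max_iff_disj)
    next
      case (2 a b c) then show ?case by (intro coupled_weight_nonneg R) auto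
    qed
    also have "\<dots> = coupled_avg (Suc n) R t x y (\<lambda>as bs cs. ?Q d bs cs) / l\<^sup>2"
    proof -
      have "real_of_int (d + b - c) + real_of_int (sum_list bs) - real_of_int (sum_list cs) =
          real_of_int d + real_of_int (sum_list (b # bs)) - real_of_int (sum_list (c # cs))" for b c bs cs
        by simp
      then show ?thesis
        unfolding coupled_avg.simps sum_divide_distrib times_divide_eq_right by (simp only:)
    qed
    finally show ?thesis .
  qed
qed

text \<open>The discrete Tanaka formula: \<open>\<bar>S - S'\<bar>\<close> is a submartingale that gains at least \<open>\<delta>\<close> in
  each step that starts with the two walks together, which are the only steps that contribute to the
  variance of the discrepancy.\<close>

lemma coupled_avg_tanaka:
  assumes R: "\<And>t x. 0 \<le> R t x" "\<And>t x. R t x \<le> 1 - \<delta>" and "\<delta> > 0"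
  shows "coupled_avg n R t x y (\<lambda>as bs cs. (d + real_of_int (sum_list bs) - real_of_int (sum_list cs))\<^sup>2) \<le>
    d\<^sup>2 + 2 / \<delta> * (coupled_avg n R t x y (\<lambda>as bs cs. \<bar>real_of_int (x - y + sum_list as - sum_list bs)\<bar>)
       - \<bar>real_of_int (x - y)\<bar>)"
proof (induction n arbitrary: t x y d)
  case (Suc n)
  have R1: "R t x \<le> 1" for t x using R(2)[of t x] \<open>\<delta> > 0\<close> by simp
  let ?A = "\<lambda>x y as bs. \<bar>real_of_int (x - y + sum_list as - sum_list bs)\<bar>"
  let ?W = "coupled_weight (R t) x y"
  let ?N = "\<lambda>a b. coupled_avg n R (Suc t) (x + a) (y + b) (\<lambda>as bs cs. ?A (x + a) (y + b) as bs)"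
  \<comment> \<open>Puts the distance \<open>v\<close> after one step into the one-step estimate;
    the terms \<open>m\<close> reassemble to the average of the final distance over
    \<open>Suc n\<close> steps.\<close>
  have split: "(\<Sum>a\<in>A. \<Sum>b\<in>A. \<Sum>c\<in>A. w a b c * (u b c + k * (m a b - v a b))) =
    (\<Sum>a\<in>A. \<Sum>b\<in>A. \<Sum>c\<in>A. w a b c * (u b c - k * v a b)) +
    k * (\<Sum>a\<in>A. \<Sum>b\<in>A. \<Sum>c\<in>A. w a b c * m a b)"
    for A :: "int set" and w u m v and k :: real
    unfolding sum_distrib_left sum.distrib[symmetric] by (intro sum.cong) (auto simp: algebra_simps)
  have step: "(\<Sum>a\<in>{-1,1}. \<Sum>b\<in>{-1,1}. \<Sum>c\<in>{-1,1}. ?W a b c *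
      ((d + real_of_int b - real_of_int c)\<^sup>2 - 2 / \<delta> * \<bar>real_of_int (x + a - (y + b))\<bar>))
      \<le> d\<^sup>2 - 2 / \<delta> * \<bar>real_of_int (x - y)\<bar>"
  proof (cases "x = y")
    case True
    \<comment> \<open>Together: \<open>b\<close> and \<open>c\<close> are independent, so the
      discrepancy gains variance 2. The distance becomes 2 with probability
      \<open>(1 - r) / 2\<close>, a mean gain of \<open>1 - r\<close>, which is at least \<delta>;
      this fixes the factor \<open>2 / \<delta>\<close>.\<close>
    have "(\<Sum>a\<in>{-1,1}. \<Sum>b\<in>{-1,1}. \<Sum>c\<in>{-1,1}. ?W a b c *
      ((d + real_of_int b - real_of_int c)\<^sup>2 - 2 / \<delta> * \<bar>real_of_int (x + a - (y + b))\<bar>))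
      = d\<^sup>2 + 2 - 2 / \<delta> * (1 - R t x)"
      using True \<open>\<delta> > 0\<close> by (simp add: coupled_weight_def field_simps power2_eq_square)
    moreover have "2 \<le> 2 / \<delta> * (1 - R t x)" using R(2)[of t x] \<open>\<delta> > 0\<close> by (simp add: field_simps)
    ultimately show ?thesis using True by simp
  next
    case False
    \<comment> \<open>Apart: \<open>b = c\<close> leaves the discrepancy unchanged, and
      \<open>a - b\<close> is 0 with weight 1/2 and 2 or -2 with weight 1/4 each, so convexity of
      the absolute value suffices.\<close>
    have amb: "\<bar>u\<bar> \<le> (2 * \<bar>u\<bar> + \<bar>u + 2\<bar> + \<bar>u - 2\<bar>) / 4" for u :: real by (simp add: abs_if)
    have "(\<Sum>a\<in>{-1,1}. \<Sum>b\<in>{-1,1}. \<Sum>c\<in>{-1,1}. ?W a b c *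
      ((d + real_of_int b - real_of_int c)\<^sup>2 - 2 / \<delta> * \<bar>real_of_int (x + a - (y + b))\<bar>))
      = d\<^sup>2 - 2 / \<delta> * ((2 * \<bar>real_of_int (x - y)\<bar> + \<bar>real_of_int (x - y) + 2\<bar> + \<bar>real_of_int (x - y) - 2\<bar>) / 4)"
      using False \<open>\<delta> > 0\<close> by (simp add: coupled_weight_def field_simps power2_eq_square)
    also have "\<dots> \<le> d\<^sup>2 - 2 / \<delta> * \<bar>real_of_int (x - y)\<bar>"
      using \<open>\<delta> > 0\<close> by (intro diff_left_mono mult_left_mono) (use amb in auto)
    finally show ?thesis .
  qed
  have "coupled_avg (Suc n) R t x y (\<lambda>as bs cs. (d + real_of_int (sum_list bs) - real_of_int (sum_list cs))\<^sup>2) \<le>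
    (\<Sum>a\<in>{-1,1}. \<Sum>b\<in>{-1,1}. \<Sum>c\<in>{-1,1}. ?W a b c *
      ((d + real_of_int b - real_of_int c)\<^sup>2 + 2 / \<delta> * (?N a b - \<bar>real_of_int (x + a - (y + b))\<bar>)))"
    unfolding coupled_avg.simps
  proof ((rule sum_mono)+, rule mult_left_mono, goal_cases)
    case (1 a b c)
    show "coupled_avg n R (Suc t) (x + a) (y + b) (\<lambda>as bs cs. (d + real_of_int (sum_list (b # bs)) -
         real_of_int (sum_list (c # cs)))\<^sup>2) \<le>
       (d + real_of_int b - real_of_int c)\<^sup>2 + 2 / \<delta> * (?N a b - \<bar>real_of_int (x + a - (y + b))\<bar>)"
    proof -
      have "d + real_of_int (sum_list (b # bs)) - real_of_int (sum_list (c # cs)) =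
        d + real_of_int b - real_of_int c + real_of_int (sum_list bs) - real_of_int (sum_list cs)" for bs cs
        by simp
      then show ?thesis using Suc.IH[of "Suc t" "x + a" "y + b" "d + real_of_int b - real_of_int c"]
        by (simp only:)
    qed
  next
    case (2 a b c) then show ?case by (intro coupled_weight_nonneg R R1) auto
  qed
  also have "\<dots> = (\<Sum>a\<in>{-1,1}. \<Sum>b\<in>{-1,1}. \<Sum>c\<in>{-1,1}. ?W a b c *
      ((d + real_of_int b - real_of_int c)\<^sup>2 - 2 / \<delta> * \<bar>real_of_int (x + a - (y + b))\<bar>)) +
      2 / \<delta> * (\<Sum>a\<in>{-1,1}. \<Sum>b\<in>{-1,1}. \<Sum>c\<in>{-1,1}. ?W a b c * ?N a b)"
    by (rule split)
  also have "(\<Sum>a\<in>{-1,1}. \<Sum>b\<in>{-1,1}. \<Sum>c\<in>{-1,1}. ?W a b c * ?N a b) =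
     coupled_avg (Suc n) R t x y (\<lambda>as bs cs. ?A x y as bs)"
    unfolding coupled_avg.simps by (intro sum.cong refl arg_cong2[where f = "(*)"])
      (simp add: algebra_simps)
  finally show ?case using step by (simp only: right_diff_distrib)
qed simp

text \<open>Independent steps would add variance exactly 2; at a common site the correlation
  \<open>R t x\<close> is nonnegative and can only reduce it.\<close>

lemma coupled_avg_dist_square:
  assumes R: "\<And>t x. 0 \<le> R t x" "\<And>t x. R t x \<le> 1"
  shows "coupled_avg n R t x y (\<lambda>as bs cs. (z + real_of_int (sum_list as) - real_of_int (sum_list bs))\<^sup>2) \<le>
    z\<^sup>2 + 2 * real n"
proof (induction n arbitrary: t x y z)
  case (Suc n)
  have "coupled_avg (Suc n) R t x y (\<lambda>as bs cs. (z + real_of_int (sum_list as) - real_of_int (sum_list bs))\<^sup>2) \<le>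
    (\<Sum>a\<in>{-1,1}. \<Sum>b\<in>{-1,1}. \<Sum>c\<in>{-1,1}. coupled_weight (R t) x y a b c *
      ((z + real_of_int a - real_of_int b)\<^sup>2 + 2 * real n))"
    unfolding coupled_avg.simps
  proof (intro sum_mono mult_left_mono coupled_weight_nonneg R)
    fix a b c
    show "coupled_avg n R (Suc t) (x + a) (y + b) (\<lambda>as bs cs. (z + real_of_int (sum_list (a # as)) -
         real_of_int (sum_list (b # bs)))\<^sup>2) \<le> (z + real_of_int a - real_of_int b)\<^sup>2 + 2 * real n"
      using Suc.IH[of "Suc t" "x + a" "y + b" "z + real_of_int a - real_of_int b"]
      by (simp add: algebra_simps)
  qed auto
  also have "\<dots> \<le> z\<^sup>2 + 2 * real (Suc n)"
    using R(1)[of t y] by (simp add: coupled_weight_def algebra_simps power2_eq_square)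
  finally show ?case .
qed simp

lemma coupled_avg_dist:
  assumes R: "\<And>t x. 0 \<le> R t x" "\<And>t x. R t x \<le> 1"
  shows "coupled_avg n R t x y (\<lambda>as bs cs. \<bar>real_of_int (x - y + sum_list as - sum_list bs)\<bar>)
    \<le> \<bar>real_of_int (x - y)\<bar> + sqrt (2 * real n)"
proof (cases "n = 0")
  case False
  define s where "s = sqrt (2 * real n)"
  have s: "s > 0" "s\<^sup>2 = 2 * real n" using False by (auto simp: s_def)
  \<comment> \<open>Replaces the Cauchy-Schwarz inequality by a bound that is linear in the second
    moment; \<open>s\<close> is the root of the variance bound, the optimal choice.\<close>
  have amgm: "\<bar>v\<bar> \<le> 1 / (2 * s) * v\<^sup>2 + s / 2" for v :: real
  proof -
    have "0 \<le> (\<bar>v\<bar> - s)\<^sup>2" by simp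
    also have "\<dots> = v\<^sup>2 + s\<^sup>2 - 2 * s * \<bar>v\<bar>" by (simp add: power2_diff algebra_simps)
    finally show ?thesis using s(1) by (simp add: field_simps power2_eq_square)
  qed
  have "coupled_avg n R t x y (\<lambda>as bs cs. \<bar>real_of_int (x - y + sum_list as - sum_list bs)\<bar>) \<le>
    coupled_avg n R t x y (\<lambda>as bs cs. 1 / (2 * s) *
      (0 + real_of_int (sum_list as) - real_of_int (sum_list bs))\<^sup>2 + (\<bar>real_of_int (x - y)\<bar> + s / 2))"
  proof (rule coupled_avg_mono[OF R])
    fix as bs :: "int list"
    show "\<bar>real_of_int (x - y + sum_list as - sum_list bs)\<bar> \<le> 1 / (2 * s) *
      (0 + real_of_int (sum_list as) - real_of_int (sum_list bs))\<^sup>2 + (\<bar>real_of_int (x - y)\<bar> + s / 2)"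
      using amgm[of "0 + real_of_int (sum_list as) - real_of_int (sum_list bs)"] by simp
  qed
  also have "\<dots> = 1 / (2 * s) * coupled_avg n R t x y (\<lambda>as bs cs.
      (0 + real_of_int (sum_list as) - real_of_int (sum_list bs))\<^sup>2) + (\<bar>real_of_int (x - y)\<bar> + s / 2)"
    by (simp only: coupled_avg_add coupled_avg_cmult coupled_avg_const)
  also have "\<dots> \<le> 1 / (2 * s) * (0\<^sup>2 + 2 * real n) + (\<bar>real_of_int (x - y)\<bar> + s / 2)"
    using s(1) by (intro add_right_mono mult_left_mono coupled_avg_dist_square R) auto
  also have "\<dots> = \<bar>real_of_int (x - y)\<bar> + s"
    using s by (simp add: field_simps power2_eq_square)
  finally show ?thesis by (simp add: s_def)
qed simp

text \<open>Doob's inequality, then Tanaka's formula, then the bound on the mean distance. The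
  initial distance cancels, so the estimate does not depend on \<open>x\<close> and
  \<open>y\<close>; otherwise it could not be applied at the start of every block.\<close>

lemma coupled_avg_discrepancy:
  assumes R: "\<And>t x. 0 \<le> R t x" "\<And>t x. R t x \<le> 1 - \<delta>" and "\<delta> > 0" "l > 0"
  shows "coupled_avg n R t x y (\<lambda>as bs cs. of_bool (diff_max 0 bs cs \<ge> l)) \<le>
    2 * sqrt (2 * real n) / (\<delta> * l\<^sup>2)"
proof -
  have R1: "R t x \<le> 1" for t x using R(2)[of t x] \<open>\<delta> > 0\<close> by simp
  have "coupled_avg n R t x y (\<lambda>as bs cs. of_bool (diff_max 0 bs cs \<ge> l)) \<le>
    coupled_avg n R t x y (\<lambda>as bs cs.
      (real_of_int 0 + real_of_int (sum_list bs) - real_of_int (sum_list cs))\<^sup>2) / l\<^sup>2"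
    by (rule coupled_avg_diff_max) (use assms R1 in auto)
  also have "\<dots> \<le> (0\<^sup>2 + 2 / \<delta> * (coupled_avg n R t x y
       (\<lambda>as bs cs. \<bar>real_of_int (x - y + sum_list as - sum_list bs)\<bar>) - \<bar>real_of_int (x - y)\<bar>)) / l\<^sup>2"
    using coupled_avg_tanaka[of R \<delta> n t x y 0] assms by (intro divide_right_mono) auto
  also have "\<dots> \<le> (0\<^sup>2 + 2 / \<delta> * (\<bar>real_of_int (x - y)\<bar> + sqrt (2 * real n) - \<bar>real_of_int (x - y)\<bar>)) / l\<^sup>2"
    using \<open>\<delta> > 0\<close> R R1
    by (intro divide_right_mono add_left_mono mult_left_mono diff_right_mono coupled_avg_dist) auto
  finally show ?thesis by simp
qed

subsection \<open>The block functional\<close>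

text \<open>It is 1 up to level \<open>3 / 2 * 8 ^ k\<close>, 0 from \<open>3 * 8 ^ k\<close> on,
  and linear between. The scale is the square root of the block length \<open>64 ^ k\<close>, as for
  a diffusive path.\<close>

definition block_cutoff :: "nat \<Rightarrow> int list \<Rightarrow> real" where
  "block_cutoff k as = max 0 (min 1 (2 - 2 * path_max 0 as / (3 * 8 ^ k)))"

definition block_mean :: "nat \<Rightarrow> real" where
  "block_mean k = walk_avg (64 ^ k) (block_cutoff k)"

primrec block_len :: "nat \<Rightarrow> nat \<Rightarrow> nat" where
  "block_len 0 k = 0"
| "block_len (Suc n) k = 64 ^ k + block_len n (Suc k)"

primrec block_prod :: "nat \<Rightarrow> nat \<Rightarrow> int list \<Rightarrow> real" where
  "block_prod 0 k as = 1"
| "block_prod (Suc n) k as = block_cutoff k (take (64 ^ k) as) * block_prod n (Suc k) (drop (64 ^ k) as)"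

lemma block_cutoff_range: "0 \<le> block_cutoff k as" "block_cutoff k as \<le> 1"
  by (auto simp: block_cutoff_def)

lemma block_prod_range: "0 \<le> block_prod n k as \<and> block_prod n k as \<le> 1"
proof (induction n arbitrary: k as)
  case (Suc n)
  show ?case using Suc[of "Suc k" "drop (64 ^ k) as"] block_cutoff_range[of k "take (64 ^ k) as"]
    by (auto intro: mult_le_one)
qed simp

text \<open>Kolmogorov's inequality at level \<open>3 / 2 * 8 ^ k\<close> bounds the failure
  probability by 4/9, at every scale. A lower bound uniform in \<open>k\<close> is what turns
  additive errors in the correlations into multiplicative ones.\<close>

lemma block_mean_ge: "1 / 2 \<le> block_mean k"
proof -
  define l :: real where "l = 3 / 2 * 8 ^ k"
  have "(64::real) ^ k = 8 ^ k * 8 ^ k" by (simp flip: power_mult_distrib)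
  then have l: "l > 0" "l\<^sup>2 = 9 / 4 * 64 ^ k"
    by (auto simp: l_def power2_eq_square)
  have "1 - 4 / 9 \<le> 1 - walk_avg (64 ^ k) (\<lambda>as. of_bool (path_max 0 as \<ge> l))"
    using walk_avg_path_max[OF l(1), of "64 ^ k" 0] by (simp add: l)
  also have "\<dots> = walk_avg (64 ^ k) (\<lambda>as. 1 + (-1) * of_bool (path_max 0 as \<ge> l))"
    by (simp only: walk_avg_add walk_avg_cmult walk_avg_const)
  also have "\<dots> \<le> walk_avg (64 ^ k) (block_cutoff k)"
    by (rule walk_avg_mono) (auto simp: block_cutoff_def l_def field_simps)
  finally show ?thesis by (simp add: block_mean_def)
qed

lemma block_cutoff_diff:
  assumes "length bs = length cs" "\<epsilon> > 0"
  shows "\<bar>block_cutoff k bs - block_cutoff k cs\<bar> \<le>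
    \<epsilon> + of_bool (diff_max 0 bs cs \<ge> \<epsilon> * (3 / 2 * 8 ^ k))"
proof (cases "diff_max 0 bs cs \<ge> \<epsilon> * (3 / 2 * 8 ^ k)")
  case True
  then show ?thesis
    using block_cutoff_range[of k bs] block_cutoff_range[of k cs] assms(2) by (simp add: abs_le_iff)
next
  case False
  have "\<bar>path_max 0 bs - path_max 0 cs\<bar> \<le> \<epsilon> * (3 / 2 * 8 ^ k)"
    using path_max_diff[OF assms(1), of 0 0] False by simp
  then have "\<bar>path_max 0 bs - path_max 0 cs\<bar> / (3 / 2 * 8 ^ k) \<le> \<epsilon>"
    by (simp add: pos_divide_le_eq)
  then have "\<bar>(path_max 0 bs - path_max 0 cs) / (3 / 2 * 8 ^ k)\<bar> \<le> \<epsilon>"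
    unfolding abs_divide by simp
  also have "(path_max 0 bs - path_max 0 cs) / (3 / 2 * 8 ^ k) =
      2 * path_max 0 bs / (3 * 8 ^ k) - 2 * path_max 0 cs / (3 * 8 ^ k)"
    by (simp add: diff_divide_distrib)
  finally show ?thesis using False unfolding block_cutoff_def by auto
qed

lemma block_pair_le_mean:
  assumes R: "\<And>t x. 0 \<le> R t x" "\<And>t x. R t x \<le> 1"
  shows "pair_avg (64 ^ k) R t x y (\<lambda>as bs. block_cutoff k as * block_cutoff k bs) \<le> block_mean k"
proof -
  have "pair_avg (64 ^ k) R t x y (\<lambda>as bs. block_cutoff k as * block_cutoff k bs) \<le>
     pair_avg (64 ^ k) R t x y (\<lambda>as bs. block_cutoff k as)"
    by (rule pair_avg_mono[OF R]) (auto intro: mult_left_le block_cutoff_range)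
  then show ?thesis by (simp add: pair_avg_fst block_mean_def)
qed

text \<open>Replacing the second walk by the third makes the expectation factorise. The cost is the
  change of the cutoff, at most \<epsilon>, plus the probability that the discrepancy exceeds the
  corresponding level.\<close>

lemma block_pair_decorrelation:
  assumes R: "\<And>t x. 0 \<le> R t x" "\<And>t x. R t x \<le> 1 - \<delta>" and \<delta>: "\<delta> > 0" "8 ^ i / 3 \<le> \<delta> * 8 ^ k"
  shows "pair_avg (64 ^ k) R t x y (\<lambda>as bs. block_cutoff k as * block_cutoff k bs) \<le>
    (block_mean k)\<^sup>2 + 5 / 2 ^ i"
proof -
  let ?C = "coupled_avg (64 ^ k) R t x y" and ?f = "block_cutoff k"
  \<comment> \<open>Smaller \<epsilon> raises the probability of a large discrepancy like
    \<open>1 / \<epsilon>^2\<close>, that is by \<open>4 ^ i\<close>, against a gain of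
    \<open>8 ^ i\<close> from the hypothesis on \<delta>. Both errors are then of order
    \<open>2 ^ - i\<close>, summable over the blocks, with total constant 1 + 4.\<close>
  define \<epsilon> :: real where "\<epsilon> = 1 / 2 ^ i"
  define l where "l = \<epsilon> * (3 / 2 * 8 ^ k)"
  have pos: "\<epsilon> > 0" "l > 0" by (auto simp: \<epsilon>_def l_def)
  have R1: "R t x \<le> 1" for t x using R(2)[of t x] \<delta>(1) by simp
  have sq: "\<And>n. (64::real) ^ n = 8 ^ n * 8 ^ n" by (simp flip: power_mult_distrib)
  have "sqrt 2 \<le> 3 / 2" by (rule real_le_lsqrt) (auto simp: power2_eq_square)
  have "pair_avg (64 ^ k) R t x y (\<lambda>as bs. ?f as * ?f bs) = ?C (\<lambda>as bs cs. ?f as * ?f bs)"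
    by (simp add: coupled_avg_pair)
  also have "\<dots> \<le> ?C (\<lambda>as bs cs. ?f as * ?f cs + (\<epsilon> + of_bool (diff_max 0 bs cs \<ge> l)))"
  proof (rule coupled_avg_mono[OF R(1) R1])
    fix as bs cs :: "int list" assume len: "length bs = 64 ^ k" "length cs = 64 ^ k"
    have "?f as * ?f bs - ?f as * ?f cs = ?f as * (?f bs - ?f cs)" by (simp add: algebra_simps)
    also have "\<dots> \<le> ?f as * \<bar>?f bs - ?f cs\<bar>"
      by (intro mult_left_mono block_cutoff_range) auto
    also have "\<dots> \<le> 1 * \<bar>?f bs - ?f cs\<bar>"
      by (intro mult_right_mono block_cutoff_range) auto
    also have "\<dots> \<le> \<epsilon> + of_bool (diff_max 0 bs cs \<ge> l)"
      using block_cutoff_diff[of bs cs \<epsilon> k] len pos by (simp add: l_def)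
    finally show "?f as * ?f bs \<le> ?f as * ?f cs + (\<epsilon> + of_bool (diff_max 0 bs cs \<ge> l))" by simp
  qed
  also have "\<dots> = walk_avg (64 ^ k) (\<lambda>as. walk_avg (64 ^ k) (\<lambda>cs. ?f as * ?f cs)) +
      (\<epsilon> + ?C (\<lambda>as bs cs. of_bool (diff_max 0 bs cs \<ge> l)))"
    using coupled_avg_indep[of "64 ^ k" R t x y "\<lambda>as cs. ?f as * ?f cs"] by (simp add: coupled_avg_add)
  also have "walk_avg (64 ^ k) (\<lambda>as. walk_avg (64 ^ k) (\<lambda>cs. ?f as * ?f cs)) = (block_mean k)\<^sup>2"
    using walk_avg_cmult[of "64 ^ k" "block_mean k" ?f]
    by (simp add: walk_avg_cmult block_mean_def power2_eq_square mult.commute)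
  also have "?C (\<lambda>as bs cs. of_bool (diff_max 0 bs cs \<ge> l)) \<le> 2 * sqrt (2 * real (64 ^ k)) / (\<delta> * l\<^sup>2)"
    by (rule coupled_avg_discrepancy) (use assms pos in auto)
  also have "sqrt (2 * real (64 ^ k)) = sqrt 2 * 8 ^ k"
    by (simp add: sq real_sqrt_mult)
  also have "2 * (sqrt 2 * 8 ^ k) / (\<delta> * l\<^sup>2) \<le> 4 / 2 ^ i"
  proof -
    have "2 * (sqrt 2 * 8 ^ k) \<le> 3 * 8 ^ k" using \<open>sqrt 2 \<le> 3 / 2\<close> by simp
    also have "\<dots> = 4 / 2 ^ i * (8 ^ i / 3 * 8 ^ k * (9 / 4) / 4 ^ i)"
    proof -
      have "(8::real) ^ i = 2 ^ i * 4 ^ i" by (simp flip: power_mult_distrib)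
      then show ?thesis by simp
    qed
    also have "\<dots> \<le> 4 / 2 ^ i * (\<delta> * 8 ^ k * 8 ^ k * (9 / 4) / 4 ^ i)"
      by (intro mult_left_mono divide_right_mono mult_right_mono \<delta>) auto
    also have "\<dots> = 4 / 2 ^ i * (\<delta> * l\<^sup>2)"
    proof -
      have "(4::real) ^ i = 2 ^ i * 2 ^ i" by (simp flip: power_mult_distrib)
      then show ?thesis by (simp add: l_def \<epsilon>_def power2_eq_square)
    qed
    finally show ?thesis using pos \<delta>(1) by (simp add: pos_divide_le_eq)
  qed
  finally show ?thesis by (simp add: \<epsilon>_def)
qed

lemma walk_avg_block_prod:
  "walk_avg (block_len n k) (block_prod n k) = (\<Prod>j<n. block_mean (k + j))"
proof (induction n arbitrary: k)
  case (Suc n)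
  have "walk_avg (block_len (Suc n) k) (block_prod (Suc n) k) =
    walk_avg (64 ^ k) (\<lambda>as. walk_avg (block_len n (Suc k))
      (\<lambda>bs. block_cutoff k (take (64 ^ k) (as @ bs)) * block_prod n (Suc k) (drop (64 ^ k) (as @ bs))))"
    by (simp add: walk_avg_append)
  also have "\<dots> = walk_avg (64 ^ k) (\<lambda>as. (\<Prod>j<n. block_mean (Suc k + j)) * block_cutoff k as)"
    by (rule walk_avg_cong) (simp add: walk_avg_cmult Suc.IH mult.commute)
  also have "\<dots> = (\<Prod>j<Suc n. block_mean (k + j))"
    unfolding walk_avg_cmult prod.lessThan_Suc_shift by (simp add: block_mean_def mult.commute)
  finally show ?case .
qed simp

text \<open>The bound \<open>G j\<close> holds from every time and every pair of positions, so the
  later blocks are bounded conditionally on the first one, as by a Markov property.\<close>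

lemma pair_avg_block_prod:
  assumes R: "\<And>t x. 0 \<le> R t x" "\<And>t x. R t x \<le> 1"
  assumes G: "\<And>j t x y. pair_avg (64 ^ j) R t x y (\<lambda>as bs. block_cutoff j as * block_cutoff j bs) \<le> G j"
    and G0: "\<And>j. 0 \<le> G j"
  shows "pair_avg (block_len n k) R t x y (\<lambda>as bs. block_prod n k as * block_prod n k bs) \<le> (\<Prod>j<n. G (k + j))"
proof (induction n arbitrary: k t x y)
  case (Suc n)
  let ?P = "block_prod n (Suc k)" and ?f = "block_cutoff k"
  have "pair_avg (block_len (Suc n) k) R t x y (\<lambda>as bs. block_prod (Suc n) k as * block_prod (Suc n) k bs) =
    pair_avg (64 ^ k) R t x y (\<lambda>as bs. pair_avg (block_len n (Suc k)) R (t + 64 ^ k) (x + sum_list as)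
      (y + sum_list bs) (\<lambda>as' bs'. (?f (take (64 ^ k) (as @ as')) * ?P (drop (64 ^ k) (as @ as'))) *
         (?f (take (64 ^ k) (bs @ bs')) * ?P (drop (64 ^ k) (bs @ bs')))))"
    by (simp add: pair_avg_append)
  also have "\<dots> \<le> pair_avg (64 ^ k) R t x y (\<lambda>as bs. (\<Prod>j<n. G (Suc k + j)) * (?f as * ?f bs))"
  proof (rule pair_avg_mono[OF R])
    fix as bs :: "int list" assume len: "length as = 64 ^ k" "length bs = 64 ^ k"
    have "pair_avg (block_len n (Suc k)) R (t + 64 ^ k) (x + sum_list as)
      (y + sum_list bs) (\<lambda>as' bs'. (?f (take (64 ^ k) (as @ as')) * ?P (drop (64 ^ k) (as @ as'))) *
         (?f (take (64 ^ k) (bs @ bs')) * ?P (drop (64 ^ k) (bs @ bs')))) =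
      pair_avg (block_len n (Suc k)) R (t + 64 ^ k) (x + sum_list as)
      (y + sum_list bs) (\<lambda>as' bs'. (?f as * ?f bs) * (?P as' * ?P bs'))"
      using len by (simp add: algebra_simps)
    also have "\<dots> = (?f as * ?f bs) * pair_avg (block_len n (Suc k)) R (t + 64 ^ k) (x + sum_list as)
      (y + sum_list bs) (\<lambda>as' bs'. ?P as' * ?P bs')" by (rule pair_avg_cmult)
    also have "\<dots> \<le> (?f as * ?f bs) * (\<Prod>j<n. G (Suc k + j))"
      by (intro mult_left_mono Suc.IH) (simp add: block_cutoff_range)
    finally show "pair_avg (block_len n (Suc k)) R (t + 64 ^ k) (x + sum_list as)
      (y + sum_list bs) (\<lambda>as' bs'. (?f (take (64 ^ k) (as @ as')) * ?P (drop (64 ^ k) (as @ as'))) *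
         (?f (take (64 ^ k) (bs @ bs')) * ?P (drop (64 ^ k) (bs @ bs')))) \<le>
      (\<Prod>j<n. G (Suc k + j)) * (?f as * ?f bs)" by (simp add: mult.commute)
  qed
  also have "\<dots> = (\<Prod>j<n. G (Suc k + j)) * pair_avg (64 ^ k) R t x y (\<lambda>as bs. ?f as * ?f bs)"
    by (rule pair_avg_cmult)
  also have "\<dots> \<le> (\<Prod>j<n. G (Suc k + j)) * G k"
    by (intro mult_left_mono G prod_nonneg) (simp add: G0)
  also have "\<dots> = (\<Prod>j<Suc n. G (k + j))"
    unfolding prod.lessThan_Suc_shift by (simp add: mult.commute)
  finally show ?case .
qed simp

lemma prod_block_ratio_le:
  fixes k0 :: nat
  defines "g \<equiv> (\<lambda>j. if j < k0 then 2 else 1 + 20 / 2 ^ (j - k0) :: real)"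
  shows "(\<Prod>j<n. g j) \<le> 2 ^ k0 * exp 40"
proof -
  \<comment> \<open>\<open>40 - 40 / 2 ^ i\<close> is the partial sum of \<open>20 / 2 ^ l\<close>
    over \<open>l < i\<close>; the exact value is kept so that the induction closes.\<close>
  have "(\<Prod>j<n. g j) \<le> (if n \<le> k0 then 2 ^ n else 2 ^ k0 * exp (40 - 40 / 2 ^ (n - k0)))"
  proof (induction n)
    case (Suc n)
    have g0: "0 \<le> g n" by (simp add: g_def)
    consider "n < k0" | "n = k0" | "n > k0" by linarith
    then show ?case
    proof cases
      case 1
      with Suc g0 have "(\<Prod>j<n. g j) * g n \<le> 2 ^ n * g n" by (intro mult_right_mono) auto
      with 1 show ?thesis by (simp add: g_def mult.commute)
    next
      case 2
      have "1 + 20 \<le> exp (20::real)" by (rule exp_ge_add_one_self)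
      with 2 Suc g0 have "(\<Prod>j<n. g j) * g n \<le> 2 ^ n * exp 20" by (intro mult_mono) (auto simp: g_def)
      with 2 show ?thesis by simp
    next
      case 3
      have "g n \<le> exp (20 / 2 ^ (n - k0))"
        using 3 by (simp add: g_def)
      with 3 Suc g0 have "(\<Prod>j<n. g j) * g n \<le> (2 ^ k0 * exp (40 - 40 / 2 ^ (n - k0))) * exp (20 / 2 ^ (n - k0))"
        by (intro mult_mono) auto
      also have "\<dots> = 2 ^ k0 * exp ((40 - 40 / 2 ^ (n - k0)) + 20 / 2 ^ (n - k0))"
        by (simp only: exp_add mult.assoc)
      also have "(40 - 40 / 2 ^ (n - k0)) + 20 / 2 ^ (n - k0) = 40 - 40 / (2::real) ^ (Suc n - k0)"
        using 3 by (simp add: Suc_diff_le)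
      finally show ?thesis using 3 by simp
    qed
  qed simp
  also have "\<dots> \<le> 2 ^ k0 * exp 40"
  proof (cases "n \<le> k0")
    case True
    have "(2::real) ^ n * 1 \<le> 2 ^ k0 * exp 40" using True by (intro mult_mono power_increasing) auto
    then show ?thesis using True by simp
  qed simp
  finally show ?thesis .
qed

text \<open>\<open>k0\<close> is the first scale at which the two dynamical times decorrelate. Each
  of the \<open>k0\<close> shorter blocks costs a factor 2, and the longer blocks cost a bounded
  factor altogether.\<close>

lemma pair_avg_block_prod_le:
  assumes R: "\<And>t x. 0 \<le> R t x" "\<And>t x. R t x \<le> 1 - \<theta> / 3" and \<theta>: "0 < \<theta>" "\<theta> \<le> 1"
  shows "pair_avg (block_len n 0) R t x y (\<lambda>as bs. block_prod n 0 as * block_prod n 0 bs) \<le>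
    (\<Prod>j<n. block_mean j)\<^sup>2 * (exp 40 * sqrt (8 / \<theta>))"
proof -
  have R1: "R t x \<le> 1" for t x using R(2)[of t x] \<theta>(1) by simp
  obtain n0 where "1 / \<theta> < 8 ^ n0" using real_arch_pow[of 8 "1 / \<theta>"] by auto
  then have ex: "1 \<le> 8 ^ n0 * \<theta>" using \<theta> by (simp add: field_simps)
  define k0 where "k0 = (LEAST k. 1 \<le> 8 ^ k * \<theta>)"
  have k0: "1 \<le> 8 ^ k0 * \<theta>" unfolding k0_def by (rule LeastI[where P = "\<lambda>k. 1 \<le> 8 ^ k * \<theta>", OF ex])
  have "8 ^ k0 * \<theta> \<le> 8"
  proof (cases k0)
    case (Suc k)
    then have "\<not> 1 \<le> 8 ^ k * \<theta>" using not_less_Least[of k "\<lambda>k. 1 \<le> 8 ^ k * \<theta>"] by (simp add: k0_def)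
    then show ?thesis using Suc by simp
  qed (use \<theta> in simp)
  then have k0': "8 ^ k0 \<le> 8 / \<theta>" using \<theta> by (simp add: field_simps)
  \<comment> \<open>By minimality \<open>8 ^ k0\<close> is of order \<open>1 / \<theta>\<close>, so
    \<open>2 ^ k0\<close> is of order \<theta> to the power -1/3. Any power above -1 is integrable;
    -1/2 is the convenient one.\<close>
  have "(2 ^ k0)\<^sup>2 = (4 :: real) ^ k0" by (simp add: power2_eq_square flip: power_mult_distrib)
  also have "\<dots> \<le> 8 ^ k0" by (rule power_mono) auto
  finally have two: "2 ^ k0 \<le> sqrt (8 / \<theta>)" using k0' by (intro real_le_rsqrt) simp
  define g where "g = (\<lambda>j. if j < k0 then 2 else 1 + 20 / 2 ^ (j - k0) :: real)"
  have g0: "0 \<le> g j" for j by (simp add: g_def)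
  have "pair_avg (block_len n 0) R t x y (\<lambda>as bs. block_prod n 0 as * block_prod n 0 bs) \<le>
    (\<Prod>j<n. (block_mean (0 + j))\<^sup>2 * g (0 + j))"
  proof (rule pair_avg_block_prod[OF R(1) R1, where G = "\<lambda>j. (block_mean j)\<^sup>2 * g j"])
    fix j t x y
    show "pair_avg (64 ^ j) R t x y (\<lambda>as bs. block_cutoff j as * block_cutoff j bs) \<le> (block_mean j)\<^sup>2 * g j"
    proof (cases "j < k0")
      case True
      have "pair_avg (64 ^ j) R t x y (\<lambda>as bs. block_cutoff j as * block_cutoff j bs) \<le> block_mean j"
        by (rule block_pair_le_mean[OF R(1) R1])
      \<comment> \<open>The factor 2 of a short block: one of the two cutoffs was dropped, and the
        mean is at least 1/2.\<close>
      also have "\<dots> \<le> block_mean j * (2 * block_mean j)"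
        using block_mean_ge[of j] by simp
      finally show ?thesis using True by (simp add: g_def power2_eq_square mult_ac)
    next
      case False
      have "8 ^ (j - k0) / 3 \<le> \<theta> / 3 * 8 ^ j"
      proof -
        have "8 ^ (j - k0) * 1 \<le> 8 ^ (j - k0) * (8 ^ k0 * \<theta>)" using k0 by (intro mult_left_mono) auto
        also have "\<dots> = 8 ^ (j - k0 + k0) * \<theta>" by (simp only: power_add mult_ac)
        also have "j - k0 + k0 = j" using False by simp
        finally show ?thesis by (simp add: mult.commute)
      qed
      then have "pair_avg (64 ^ j) R t x y (\<lambda>as bs. block_cutoff j as * block_cutoff j bs) \<le>
          (block_mean j)\<^sup>2 + 5 / 2 ^ (j - k0)"
        using R \<theta> by (intro block_pair_decorrelation[where \<delta> = "\<theta> / 3"]) auto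
      \<comment> \<open>The squared mean is at least 1/4, which turns 5 into 20.\<close>
      also have "\<dots> \<le> (block_mean j)\<^sup>2 + (block_mean j)\<^sup>2 * 20 / 2 ^ (j - k0)"
      proof -
        have "(1 / 2)\<^sup>2 \<le> (block_mean j)\<^sup>2" using block_mean_ge[of j] by (intro power_mono) auto
        then show ?thesis by (intro add_left_mono divide_right_mono) (auto simp: power2_eq_square)
      qed
      finally show ?thesis using False by (simp add: g_def algebra_simps)
    qed
  qed (simp add: g0)
  also have "\<dots> = (\<Prod>j<n. block_mean j)\<^sup>2 * (\<Prod>j<n. g j)"
    by (simp add: prod.distrib prod_power_distrib)
  also have "\<dots> \<le> (\<Prod>j<n. block_mean j)\<^sup>2 * (2 ^ k0 * exp 40)"
    unfolding g_def by (intro mult_left_mono prod_block_ratio_le) auto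
  also have "\<dots> \<le> (\<Prod>j<n. block_mean j)\<^sup>2 * (sqrt (8 / \<theta>) * exp 40)"
    using two by (intro mult_left_mono mult_right_mono) auto
  finally show ?thesis by (simp add: mult.commute)
qed

text \<open>For positive \<open>k\<close> the starting time \<open>(64 ^ k - 1) / 63\<close> is at
  least \<open>64 ^ (k - 1)\<close>, so \<open>8 ^ k\<close> is at most 8 times its root; hence 32 =
  4 * 8. The summand 4 covers \<open>k = 0\<close>.\<close>

lemma block_scale_le: "4 * 8 ^ k \<le> 4 + 32 * sqrt ((64 ^ k - 1) / 63)"
proof (cases k)
  case (Suc m)
  have "(8 ^ m)\<^sup>2 = (64::real) ^ m" by (simp add: power2_eq_square flip: power_mult_distrib)
  also have "\<dots> \<le> (64 ^ k - 1) / 63" by (simp add: Suc)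
  finally have "8 ^ m \<le> sqrt ((64 ^ k - 1) / 63)" by (rule real_le_rsqrt)
  then show ?thesis by (simp add: Suc)
qed simp

text \<open>The start of block \<open>k\<close> is the time \<open>(64 ^ k - 1) / 63\<close>, and the earlier blocks move the
  path by at most \<open>3 * (8 ^ 0 + \<dots> + 8 ^ (k - 1)) \<le> 3 / 7 * 8 ^ k\<close>.\<close>

lemma block_prod_pos_bound:
  assumes "block_prod n k as > 0" "length as = block_len n k" "\<bar>real_of_int x\<bar> \<le> 3 / 7 * 8 ^ k" "i \<le> length as"
  shows "\<bar>real_of_int (x + sum_list (take i as))\<bar> \<le> 4 + 32 * sqrt ((64 ^ k - 1) / 63 + real i)"
  using assms
proof (induction n arbitrary: k as x i)
  case 0
  then show ?case using block_scale_le[of k] by simp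
next
  case (Suc n)
  let ?T = "64 ^ k :: nat"
  have pos: "block_cutoff k (take ?T as) > 0" "block_prod n (Suc k) (drop ?T as) > 0"
    using Suc.prems(1) block_cutoff_range(1)[of k "take ?T as"] block_prod_range[of n "Suc k" "drop ?T as"]
    by (auto simp: zero_less_mult_iff)
  have "0 < 2 - 2 * path_max 0 (take ?T as) / (3 * 8 ^ k)"
    using pos(1) unfolding block_cutoff_def by (simp only: less_max_iff_disj min_less_iff_conj) simp
  then have "path_max 0 (take ?T as) \<le> 3 * 8 ^ k" by (simp add: field_simps)
  then have incr: "\<bar>real_of_int (sum_list (take m as))\<bar> \<le> 3 * 8 ^ k" if "m \<le> ?T" for m
    using path_max_take[of 0 m "take ?T as"] that by (simp add: min_absorb1)
  show ?case
  proof (cases "i \<le> ?T")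
    case True
    have "\<bar>real_of_int (x + sum_list (take i as))\<bar> \<le> 4 * 8 ^ k"
      using incr[OF True] Suc.prems(3) by simp
    also have "\<dots> \<le> 4 + 32 * sqrt ((64 ^ k - 1) / 63)" by (rule block_scale_le)
    also have "\<dots> \<le> 4 + 32 * sqrt ((64 ^ k - 1) / 63 + real i)" by simp
    finally show ?thesis .
  next
    case False
    have "\<bar>real_of_int (x + sum_list (take ?T as) + sum_list (take (i - ?T) (drop ?T as)))\<bar> \<le>
        4 + 32 * sqrt ((64 ^ Suc k - 1) / 63 + real (i - ?T))"
    proof (rule Suc.IH[OF pos(2)])
      \<comment> \<open>3/7 + 3 = 8 * 3/7, so the bound reproduces itself at the next scale. Inside
        the block, 3/7 + 3 is below 4.\<close>
      show "\<bar>real_of_int (x + sum_list (take ?T as))\<bar> \<le> 3 / 7 * 8 ^ Suc k"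
        using incr[of ?T] Suc.prems(3) abs_triangle_ineq[of "real_of_int x" "real_of_int (sum_list (take ?T as))"]
        by simp
    qed (use Suc.prems False in auto)
    also have "(64 ^ Suc k - 1) / 63 + real (i - ?T) = (64 ^ k - 1) / 63 + real i"
      using False by (simp add: of_nat_diff field_simps)
    also have "x + sum_list (take ?T as) + sum_list (take (i - ?T) (drop ?T as)) = x + sum_list (take i as)"
      using False take_add[of ?T "i - ?T" as] by simp
    finally show ?thesis .
  qed
qed

subsection \<open>A simple random walk leaves every parabola\<close>

definition in_parabola :: "real \<Rightarrow> real \<Rightarrow> nat \<Rightarrow> int list \<Rightarrow> bool" where
  "in_parabola j K n as \<longleftrightarrow> (\<forall>i\<le>n. \<bar>real_of_int (sum_list (take i as))\<bar> \<le> j + K * sqrt (real i))"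

lemma sum_list_map_uminus: "sum_list (map uminus as) = - sum_list (as :: int list)"
  by (induction as) auto

text \<open>By symmetry it suffices to bound the two-sided event by 3/16, which needs only that the
  second moment is \<open>r\<close> and the fourth is at most \<open>3 * r^2\<close>.\<close>

lemma walk_avg_diffusive:
  assumes "r \<ge> 1"
  shows "3 / 32 \<le> walk_avg r (\<lambda>as. of_bool (real_of_int (sum_list as) \<ge> sqrt r / 2))"
proof -
  let ?p = "walk_avg r (\<lambda>as. of_bool (real_of_int (sum_list as) \<ge> sqrt r / 2))"
  let ?S = "\<lambda>as. 0 + real_of_int (sum_list as)"
  have sym: "walk_avg r (\<lambda>as. of_bool (- real_of_int (sum_list as) \<ge> sqrt r / 2)) = ?p"
    using walk_avg_uminus[of r "\<lambda>as. of_bool (real_of_int (sum_list as) \<ge> sqrt r / 2)"]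
    by (simp add: sum_list_map_uminus)
  text \<open>A Paley--Zygmund bound, with the polynomial that makes it linear in the moments.\<close>
  have "3 / 16 \<le> (1 / (2 * r)) * (0\<^sup>2 + real r) + ((-1 / (16 * (real r)\<^sup>2)) * (0 ^ 4 + 6 * real r * 0\<^sup>2 + 3 * (real r)\<^sup>2) - 1 / 8)"
    using assms by (simp add: field_simps)
  also have "\<dots> \<le> (1 / (2 * r)) * walk_avg r (\<lambda>as. (?S as)\<^sup>2) +
      ((-1 / (16 * (real r)\<^sup>2)) * walk_avg r (\<lambda>as. ?S as ^ 4) - 1 / 8)"
    unfolding walk_avg_square
    by (intro add_left_mono diff_right_mono mult_left_mono_neg walk_avg_fourth) auto
  also have "\<dots> = walk_avg r (\<lambda>as. (1 / (2 * r)) * (?S as)\<^sup>2 + ((-1 / (16 * (real r)\<^sup>2)) * ?S as ^ 4 + (- 1 / 8)))"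
    unfolding walk_avg_add walk_avg_cmult walk_avg_const by simp
  also have "\<dots> \<le> walk_avg r (\<lambda>as. of_bool (real_of_int (sum_list as) \<ge> sqrt r / 2) +
      of_bool (- real_of_int (sum_list as) \<ge> sqrt r / 2))"
  proof (rule walk_avg_mono)
    fix as
    define u where "u = (real_of_int (sum_list as))\<^sup>2 / r"
    have eq: "(1 / (2 * r)) * (?S as)\<^sup>2 + ((-1 / (16 * (real r)\<^sup>2)) * ?S as ^ 4 + (- 1 / 8)) =
       u / 2 - u\<^sup>2 / 16 - 1 / 8"
      by (simp add: u_def power_divide power2_eq_square power4_eq_xxxx)
    \<comment> \<open>The polynomial is \<open>1 - (u - 4)^2 / 16 - 1 / 8\<close>, hence below 1,
      and it is at most 0 for \<open>u < 1 / 4\<close>. With moments 1 and 3 of \<open>u\<close> and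
      its square it averages to at least 1/2 - 3/16 - 1/8 = 3/16.\<close>
    have "u / 2 - u\<^sup>2 / 16 - 1 / 8 \<le> of_bool (u \<ge> 1 / 4)"
    proof -
      have "0 \<le> (u - 4)\<^sup>2" by simp
      then have "u / 2 - u\<^sup>2 / 16 \<le> 1" by (simp add: power2_eq_square algebra_simps)
      moreover have "u / 2 - u\<^sup>2 / 16 - 1 / 8 \<le> 0" if "\<not> u \<ge> 1 / 4"
      proof -
        have "0 \<le> u\<^sup>2" by simp
        with that show ?thesis by linarith
      qed
      ultimately show ?thesis by (cases "u \<ge> 1 / 4") simp_all
    qed
    also have "of_bool (u \<ge> 1 / 4) \<le> (of_bool (real_of_int (sum_list as) \<ge> sqrt r / 2) +
      of_bool (- real_of_int (sum_list as) \<ge> sqrt r / 2) :: real)"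
    proof (cases "u \<ge> 1 / 4")
      case True
      then have "(sqrt r / 2)\<^sup>2 \<le> (real_of_int (sum_list as))\<^sup>2"
        using assms by (simp add: u_def power_divide field_simps)
      then have "sqrt r / 2 \<le> \<bar>real_of_int (sum_list as)\<bar>"
        using abs_le_square_iff[of "sqrt r / 2" "real_of_int (sum_list as)"] by simp
      then show ?thesis by (auto simp: abs_if split: if_splits)
    qed simp
    finally show "(1 / (2 * r)) * (?S as)\<^sup>2 + ((-1 / (16 * (real r)\<^sup>2)) * ?S as ^ 4 + (- 1 / 8)) \<le>
      of_bool (real_of_int (sum_list as) \<ge> sqrt r / 2) + of_bool (- real_of_int (sum_list as) \<ge> sqrt r / 2)"
      unfolding eq .
  qed
  also have "\<dots> = 2 * ?p" unfolding walk_avg_add sym by simp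
  finally show ?thesis by simp
qed

text \<open>Let each of \<open>m\<close> independent stretches of length \<open>r\<close> rise by
  \<open>sqrt r / 2\<close>. The point is that the probability does not depend on
  \<open>r\<close>.\<close>

lemma walk_avg_superdiffusive:
  assumes "r \<ge> 1"
  shows "(3 / 32) ^ m \<le> walk_avg (m * r) (\<lambda>as. of_bool (real_of_int (sum_list as) \<ge> m * (sqrt r / 2)))"
proof (induction m)
  case (Suc m)
  let ?E = "\<lambda>as. of_bool (real_of_int (sum_list as) \<ge> sqrt r / 2) :: real"
  let ?F = "\<lambda>as. of_bool (real_of_int (sum_list as) \<ge> m * (sqrt r / 2)) :: real"
  have "(3 / 32) ^ Suc m \<le> walk_avg r ?E * walk_avg (m * r) ?F"
    unfolding power_Suc by (intro mult_mono Suc walk_avg_diffusive assms order_trans[OF _ walk_avg_diffusive]) auto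
  also have "\<dots> = walk_avg r (\<lambda>as. walk_avg (m * r) (\<lambda>bs. ?E as * ?F bs))"
    unfolding walk_avg_cmult using walk_avg_cmult[of r "walk_avg (m * r) ?F" ?E] by (simp add: mult.commute)
  also have "\<dots> \<le> walk_avg r (\<lambda>as. walk_avg (m * r) (\<lambda>bs. of_bool (real_of_int (sum_list (as @ bs)) \<ge> Suc m * (sqrt r / 2))))"
    by (intro walk_avg_mono) (auto simp: algebra_simps)
  also have "\<dots> = walk_avg (Suc m * r) (\<lambda>as. of_bool (real_of_int (sum_list as) \<ge> Suc m * (sqrt r / 2)))"
    unfolding mult_Suc walk_avg_append[of r "m * r"] by (rule refl)
  finally show ?case .
qed simp

text \<open>Multiplied by \<open>sqrt t\<close> with \<open>t \<ge> 1\<close>, the inequality says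
  that a rise of \<open>m * sqrt t / 2\<close> leads from the bottom of the parabola at time
  \<open>t\<close> to above its top at time \<open>(m + 1) * t\<close>. It holds for large
  \<open>m\<close> since a linear term beats a square root.\<close>

lemma superdiffusive_multiple:
  fixes j K :: real
  assumes "0 \<le> j" "0 \<le> K"
  obtains m :: nat where "2 * j + K + K * sqrt (real (Suc m)) < m / 2"
proof -
  define B where "B = 2 * j + 2 * K + 1"
  define m where "m = nat \<lceil>(4 * B)\<^sup>2\<rceil>"
  have B: "B \<ge> 1" "K \<le> B" using assms by (auto simp: B_def)
  have "(4 * B)\<^sup>2 \<le> m" unfolding m_def by linarith
  then have s: "4 * B \<le> sqrt m" using B by (intro real_le_rsqrt)
  have "sqrt (real (Suc m)) \<le> sqrt m + 1"
    using sqrt_add_le_add_sqrt[of "real m" 1] by (simp add: add.commute)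
  then have "2 * j + K + K * sqrt (real (Suc m)) \<le> 2 * j + K + K * (sqrt m + 1)"
    using assms by (intro add_left_mono mult_left_mono) auto
  also have "\<dots> \<le> B + K * sqrt m" by (simp add: B_def algebra_simps)
  also have "\<dots> < sqrt m / 2 * sqrt m"
  proof -
    have "1 \<le> sqrt m" using s B by linarith
    from mult_left_mono[OF this, of B] have "B + K * sqrt m \<le> B * sqrt m + K * sqrt m" using B by simp
    also have "\<dots> = (B + K) * sqrt m" by (simp add: algebra_simps)
    also have "\<dots> < sqrt m / 2 * sqrt m"
    proof (rule mult_strict_right_mono)
      have "B + K < 2 * B" using B assms by (simp add: B_def)
      then show "B + K < sqrt m / 2" using s B by linarith
      show "0 < sqrt m" using s B by linarith
    qed
    finally show ?thesis .
  qed
  also have "\<dots> = m / 2" by simp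
  finally show ?thesis by (rule that)
qed

text \<open>Wherever the walk is in the parabola at time \<open>t\<close>, it leaves by time
  \<open>(m + 1) * t\<close> with probability at least \<open>q\<close>, independent of
  \<open>t\<close>. Along the times \<open>(m + 1) ^ i\<close> survival decays
  geometrically.\<close>

lemma walk_avg_in_parabola:
  assumes "0 \<le> j" "0 \<le> K" "\<epsilon> > 0"
  obtains n where "walk_avg n (\<lambda>as. of_bool (in_parabola j K n as)) < \<epsilon>"
proof -
  obtain m :: nat where m: "2 * j + K + K * sqrt (real (Suc m)) < m / 2"
    using superdiffusive_multiple assms(1,2) .
  define q :: real where "q = (3 / 32) ^ m"
  have q: "0 < q" "q \<le> 1" by (auto simp: q_def power_le_one)
  let ?I = "\<lambda>n as. of_bool (in_parabola j K n as) :: real"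
  have step: "walk_avg (t + m * t) (?I (t + m * t)) \<le> (1 - q) * walk_avg t (?I t)" if t: "t \<ge> 1" for t
  proof -
    let ?E = "\<lambda>bs. of_bool (real_of_int (sum_list bs) \<ge> m * (sqrt t / 2)) :: real"
    have exit: "j + K * sqrt (real (t + m * t)) < real_of_int x + y"
      if x: "\<bar>real_of_int x\<bar> \<le> j + K * sqrt (real t)" and y: "m * (sqrt t / 2) \<le> y" for x y
    proof -
      have "sqrt (real (t + m * t)) = sqrt (real (Suc m)) * sqrt t"
        by (simp add: real_sqrt_mult[symmetric] algebra_simps)
      moreover have "(2 * j + K + K * sqrt (real (Suc m))) * sqrt t < m / 2 * sqrt t"
        using m t by (intro mult_strict_right_mono) auto
      moreover have "2 * j \<le> 2 * j * sqrt t"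
        using mult_left_mono[of 1 "sqrt t" "2 * j"] assms t by simp
      ultimately show ?thesis using x y by (simp add: algebra_simps)
    qed
    have "walk_avg (t + m * t) (?I (t + m * t)) =
        walk_avg t (\<lambda>as. walk_avg (m * t) (\<lambda>bs. ?I (t + m * t) (as @ bs)))"
      by (rule walk_avg_append)
    also have "\<dots> \<le> walk_avg t (\<lambda>as. walk_avg (m * t) (\<lambda>bs. ?I t as * (1 + (-1) * ?E bs)))"
    proof (intro walk_avg_mono)
      fix as bs :: "int list" assume len: "length as = t" "length bs = m * t"
      show "?I (t + m * t) (as @ bs) \<le> ?I t as * (1 + (-1) * ?E bs)"
      proof (cases "in_parabola j K (t + m * t) (as @ bs)")
        case True
        then have 1: "\<bar>real_of_int (sum_list (take i (as @ bs)))\<bar> \<le> j + K * sqrt (real i)" if "i \<le> t + m * t" for i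
          using that by (simp add: in_parabola_def)
        have "\<bar>real_of_int (sum_list (take i as))\<bar> \<le> j + K * sqrt (real i)" if "i \<le> t" for i
          using 1[of i] that len by simp
        then have "in_parabola j K t as" by (simp add: in_parabola_def)
        moreover have "\<not> m * (sqrt t / 2) \<le> real_of_int (sum_list bs)"
        proof
          assume "m * (sqrt t / 2) \<le> real_of_int (sum_list bs)"
          with exit[of "sum_list as" "real_of_int (sum_list bs)"] 1[of t] 1[of "t + m * t"] len show False
            by simp
        qed
        ultimately show ?thesis by simp
      qed simp
    qed
    also have "\<dots> = walk_avg t (\<lambda>as. (1 - walk_avg (m * t) ?E) * ?I t as)"
      by (rule walk_avg_cong) (simp only: walk_avg_cmult walk_avg_add walk_avg_const, simp add: algebra_simps)
    also have "\<dots> = (1 - walk_avg (m * t) ?E) * walk_avg t (?I t)" by (rule walk_avg_cmult)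
    also have "\<dots> \<le> (1 - q) * walk_avg t (?I t)"
    proof (rule mult_right_mono)
      show "1 - walk_avg (m * t) ?E \<le> 1 - q"
        using walk_avg_superdiffusive[OF t, of m] by (simp add: q_def)
      show "0 \<le> walk_avg t (?I t)"
        using walk_avg_mono[of t "\<lambda>_. 0" "?I t"] by simp
    qed
    finally show ?thesis .
  qed
  have "walk_avg ((m + 1) ^ i) (?I ((m + 1) ^ i)) \<le> (1 - q) ^ i" for i
  proof (induction i)
    case 0
    show ?case using walk_avg_mono[of 1 "?I 1" "\<lambda>_. 1"] by simp
  next
    case (Suc i)
    have "walk_avg ((m + 1) ^ Suc i) (?I ((m + 1) ^ Suc i)) \<le> (1 - q) * walk_avg ((m + 1) ^ i) (?I ((m + 1) ^ i))"
      using step[of "(m + 1) ^ i"] by (simp add: add.commute)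
    also have "\<dots> \<le> (1 - q) * (1 - q) ^ i" using Suc q by (intro mult_left_mono) auto
    finally show ?case by simp
  qed
  moreover obtain i where "(1 - q) ^ i < \<epsilon>"
    using real_arch_pow_inv[OF assms(3), of "1 - q"] q by auto
  ultimately show ?thesis using that le_less_trans by blast
qed

subsection \<open>The law of the discrete web\<close>

definition step_list :: "(int \<times> int \<Rightarrow> int) \<Rightarrow> nat \<Rightarrow> int list" where
  "step_list \<xi> n = map (\<lambda>i. \<xi> (path_steps \<xi> (0, 0) i, int i)) [0..<n]"

lemma length_step_list [simp]: "length (step_list \<xi> n) = n"
  by (simp add: step_list_def)

lemma sum_take_step_list: "i \<le> n \<Longrightarrow> sum_list (take i (step_list \<xi> n)) = path_steps \<xi> (0, 0) i"
proof (induction i)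
  case (Suc i)
  then show ?case by (simp add: take_Suc_conv_app_nth step_list_def)
qed simp

text \<open>Turns an event about a path, whose sites are random, into conditions on the arrows at
  \<open>n\<close> fixed sites. These lie at different times, so they are distinct and their arrows
  are independent.\<close>

lemma step_list_eq_iff:
  "step_list \<xi> n = as \<longleftrightarrow> length as = n \<and> (\<forall>i<n. \<xi> (sum_list (take i as), int i) = as ! i)"
proof
  assume "step_list \<xi> n = as"
  then show "length as = n \<and> (\<forall>i<n. \<xi> (sum_list (take i as), int i) = as ! i)"
    using sum_take_step_list[of _ n \<xi>] by (auto simp: step_list_def)
next
  assume as: "length as = n \<and> (\<forall>i<n. \<xi> (sum_list (take i as), int i) = as ! i)"
  have "path_steps \<xi> (0, 0) i = sum_list (take i as)" if "i \<le> n" for i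
    using that
  proof (induction i)
    case (Suc i)
    with as show ?case by (simp add: take_Suc_conv_app_nth)
  qed simp
  with as show "step_list \<xi> n = as" by (intro nth_equalityI) (auto simp: step_list_def)
qed

lemma sum_list_even_site:
  "set as \<subseteq> {-1,1} \<Longrightarrow> i \<le> length as \<Longrightarrow> (sum_list (take i as), int i) \<in> Z2_even"
proof (induction i)
  case (Suc i)
  then have "as ! i \<in> {-1,1}" using nth_mem[of i as] by (auto simp del: nth_mem)
  with Suc show ?case by (auto simp: Z2_even_def take_Suc_conv_app_nth)
qed (simp add: Z2_even_def)

lemma step_list_range:
  assumes "\<And>z. z \<in> Z2_even \<Longrightarrow> \<xi> z \<in> {-1,1}"
  shows "set (step_list \<xi> n) \<subseteq> {-1,1}"
proof -
  have "(path_steps \<xi> (0, 0) i, int i) \<in> Z2_even" for i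
  proof (induction i)
    case (Suc i)
    then show ?case using assms[OF Suc] by (auto simp: Z2_even_def)
  qed (simp add: Z2_even_def)
  then show ?thesis using assms by (auto simp: step_list_def)
qed

text \<open>The product over rows is the form in which the joint law of two walks comes out of
  independence.\<close>

lemma pair_avg_eq_sum:
  "pair_avg n R t x y F =
    (\<Sum>as | length as = n \<and> set as \<subseteq> {-1,1}. \<Sum>bs | length bs = n \<and> set bs \<subseteq> {-1,1}.
      (\<Prod>i<n. pair_weight (R (t + i)) (x + sum_list (take i as)) (y + sum_list (take i bs)) (as ! i) (bs ! i)) *
      F as bs)"
proof (induction n arbitrary: t x y F)
  case 0
  have "{as :: int list. length as = 0 \<and> set as \<subseteq> {-1,1}} = {[]}" by auto
  then show ?case by simp
next
  case (Suc n)
  let ?L = "{as :: int list. length as = n \<and> set as \<subseteq> {-1,1}}"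
  let ?w = "\<lambda>m t x y as bs. \<Prod>i<m. pair_weight (R (t + i)) (x + sum_list (take i as)) (y + sum_list (take i bs)) (as ! i) (bs ! i)"
  have w: "?w (Suc n) t x y (a # as) (b # bs) = pair_weight (R t) x y a b * ?w n (Suc t) (x + a) (y + b) as bs"
    for a b as bs
    unfolding prod.lessThan_Suc_shift by (simp add: add.assoc)
  have "pair_avg (Suc n) R t x y F = (\<Sum>a\<in>{-1,1}. \<Sum>b\<in>{-1,1}. pair_weight (R t) x y a b *
      (\<Sum>as\<in>?L. \<Sum>bs\<in>?L. ?w n (Suc t) (x + a) (y + b) as bs * F (a # as) (b # bs)))"
    unfolding pair_avg.simps Suc.IH by (rule refl)
  also have "\<dots> = (\<Sum>a\<in>{-1,1}. \<Sum>b\<in>{-1,1}. \<Sum>as\<in>?L. \<Sum>bs\<in>?L. ?w (Suc n) t x y (a # as) (b # bs) * F (a # as) (b # bs))"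
    unfolding w sum_distrib_left mult.assoc by (rule refl)
  also have "\<dots> = (\<Sum>a\<in>{-1,1}. \<Sum>as\<in>?L. \<Sum>b\<in>{-1,1}. \<Sum>bs\<in>?L. ?w (Suc n) t x y (a # as) (b # bs) * F (a # as) (b # bs))"
    by (intro sum.cong refl sum.swap)
  also have "\<dots> = (\<Sum>as | length as = Suc n \<and> set as \<subseteq> {-1,1}. \<Sum>bs | length bs = Suc n \<and> set bs \<subseteq> {-1,1}.
      ?w (Suc n) t x y as bs * F as bs)"
    unfolding sum_step_lists_Suc by (rule refl)
  finally show ?case .
qed

section \<open>Independence of the clocks and the values\<close>

context dynamical_discrete_web
begin

definition source :: "(int \<times> int) \<times> nat + (int \<times> int) \<times> nat \<Rightarrow> 'a \<Rightarrow> real" where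
  "source i = (case i of Inl (z, n) \<Rightarrow> gap z n | Inr (z, n) \<Rightarrow> (\<lambda>\<omega>. real_of_int (val z n \<omega>)))"

definition sources :: "((int \<times> int) \<times> nat + (int \<times> int) \<times> nat) set" where
  "sources = (Z2_even \<times> UNIV) <+> (Z2_even \<times> UNIV)"

text \<open>The sigma-algebra generated by the sources with index in \<open>K\<close>, as the
  pullback of a product so that independence of restricted vectors applies.\<close>

definition source_alg where
  "source_alg K = vimage_algebra (space M) (\<lambda>\<omega>. restrict (\<lambda>i. source i \<omega>) K) (PiM K (\<lambda>_. borel))"

definition gap_alg where "gap_alg = source_alg (Inl ` (Z2_even \<times> UNIV))"

lemma space_source_alg [simp]: "space (source_alg K) = space M"
  by (simp add: source_alg_def)

lemma space_gap_alg [simp]: "space gap_alg = space M"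
  by (simp add: gap_alg_def)

lemma source_measurable: "i \<in> K \<Longrightarrow> source i \<in> borel_measurable (source_alg K)"
proof -
  assume i: "i \<in> K"
  have "(\<lambda>\<omega>. restrict (\<lambda>i. source i \<omega>) K) \<in> measurable (source_alg K) (PiM K (\<lambda>_. borel))"
    unfolding source_alg_def by (rule measurable_vimage_algebra1) (auto simp: space_PiM)
  from measurable_compose[OF this measurable_component_singleton[OF i]] i show ?thesis by simp
qed

lemma gap_measurable_alg: "Inl (z, n) \<in> K \<Longrightarrow> gap z n \<in> borel_measurable (source_alg K)"
  using source_measurable[of "Inl (z, n)"] by (simp add: source_def)

lemma val_measurable_alg: "Inr (z, n) \<in> K \<Longrightarrow> val z n \<in> measurable (source_alg K) (count_space UNIV)"
proof -
  assume "Inr (z, n) \<in> K"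
  from measurable_compose[OF source_measurable[OF this] measurable_real_floor]
  show ?thesis by (simp add: source_def)
qed

lemma source_indep: "indep_vars (\<lambda>_. borel) source sources"
  using all_independent unfolding source_def[abs_def] sources_def by (simp cong: sum.case_cong)

lemma source_alg_subset: "K \<subseteq> sources \<Longrightarrow> sets (source_alg K) \<subseteq> events"
proof -
  assume K: "K \<subseteq> sources"
  have "(\<lambda>\<omega>. restrict (\<lambda>i. source i \<omega>) K) \<in> measurable M (PiM K (\<lambda>_. borel))"
    using source_indep K by (intro measurable_restrict) (auto simp: indep_vars_def)
  moreover from this have "(\<lambda>\<omega>. restrict (\<lambda>i. source i \<omega>) K) \<in> space M \<rightarrow> space (PiM K (\<lambda>_. borel))"
    by (auto dest: measurable_space)
  ultimately show ?thesis
    unfolding source_alg_def by (auto simp: sets_vimage_algebra2 intro: measurable_sets)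
qed

lemma measurable_source_alg:
  assumes "K \<subseteq> sources" "f \<in> measurable (source_alg K) N"
  shows "f \<in> measurable M N"
  using measurable_mono[OF subset_refl refl source_alg_subset[OF assms(1)]] assms(2) by auto

lemma gap_alg_subset: "sets gap_alg \<subseteq> events"
  unfolding gap_alg_def by (rule source_alg_subset) (auto simp: sources_def)

lemma measurable_gap_alg: "f \<in> measurable gap_alg N \<Longrightarrow> f \<in> measurable M N"
  unfolding gap_alg_def by (rule measurable_source_alg) (auto simp: sources_def)

text \<open>Grouping principle: an event of \<open>source_alg (K j)\<close> is a preimage under the
  vector of the sources in \<open>K j\<close>, and vectors over disjoint index sets are
  independent.\<close>

lemma source_alg_indep:
  assumes "disjoint_family_on K J" "\<And>j. j \<in> J \<Longrightarrow> K j \<subseteq> sources" "finite J"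
    and A: "\<And>j. j \<in> J \<Longrightarrow> A j \<in> sets (source_alg (K j))"
  shows "prob {\<omega> \<in> space M. \<forall>j\<in>J. \<omega> \<in> A j} = (\<Prod>j\<in>J. prob (A j))"
proof (cases "J = {}")
  case False
  let ?X = "\<lambda>j \<omega>. restrict (\<lambda>i. source i \<omega>) (K j)"
  have "\<exists>B. B \<in> sets (PiM (K j) (\<lambda>_. borel)) \<and> A j = ?X j -` B \<inter> space M" if "j \<in> J" for j
  proof -
    have "?X j \<in> space M \<rightarrow> space (PiM (K j) (\<lambda>_. borel))" by (auto simp: space_PiM)
    with A[OF that] show ?thesis by (auto simp: source_alg_def sets_vimage_algebra2)
  qed
  then obtain B where B: "\<And>j. j \<in> J \<Longrightarrow> B j \<in> sets (PiM (K j) (\<lambda>_. borel))"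
    "\<And>j. j \<in> J \<Longrightarrow> A j = ?X j -` B j \<inter> space M" by metis
  have "prob (\<Inter>j\<in>J. ?X j -` B j \<inter> space M) = (\<Prod>j\<in>J. prob (?X j -` B j \<inter> space M))"
    by (rule indep_varsD[OF indep_vars_restrict[OF source_indep assms(2,1)]]) (use B False assms in auto)
  moreover have "{\<omega> \<in> space M. \<forall>j\<in>J. \<omega> \<in> A j} = (\<Inter>j\<in>J. ?X j -` B j \<inter> space M)"
    using False B(2) by auto
  ultimately show ?thesis using B(2) by simp
qed (simp add: prob_space)

lemma val_range: "z \<in> Z2_even \<Longrightarrow> \<omega> \<in> space M \<Longrightarrow> val z n \<omega> \<in> {-1,1}"
  using measurable_space[OF val_measurable] by simp

lemma prob_val: "z \<in> Z2_even \<Longrightarrow> a \<in> {-1,1} \<Longrightarrow> prob {\<omega> \<in> space M. val z n \<omega> = a} = 1 / 2"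
proof -
  assume z: "z \<in> Z2_even" and a: "a \<in> {-1,1}"
  have "prob {\<omega> \<in> space M. val z n \<omega> = a} = measure (distr M (count_space {-1,1}) (val z n)) {a}"
    using a by (subst measure_distr[OF val_measurable[OF z]]) (auto intro!: arg_cong[where f = prob])
  also have "\<dots> = 1 / 2"
    using a unfolding val_uniform[OF z] by (subst measure_uniform_count_measure) auto
  finally show ?thesis .
qed

text \<open>Given all clocks, finitely many values with deterministic indices are fair and
  independent. In the grouping, \<open>None\<close> is the block of all clocks and
  \<open>Some p\<close> a single value.\<close>

lemma prob_gap_val:
  assumes A: "A \<in> sets gap_alg" and J: "finite J" "J \<subseteq> Z2_even \<times> UNIV" "\<And>p. p \<in> J \<Longrightarrow> a p \<in> {-1,1}"
  shows "prob {\<omega> \<in> A. \<forall>p\<in>J. val (fst p) (snd p) \<omega> = a p} = prob A * (1 / 2) ^ card J"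
proof -
  define K where "K = (\<lambda>q. case q of None \<Rightarrow> Inl ` (Z2_even \<times> UNIV) | Some p \<Rightarrow> {Inr p :: (int \<times> int) \<times> nat + (int \<times> int) \<times> nat})"
  define B where "B = (\<lambda>q. case q of None \<Rightarrow> A | Some p \<Rightarrow> {\<omega> \<in> space M. val (fst p) (snd p) \<omega> = a p})"
  let ?J = "insert None (Some ` J)"
  have "prob {\<omega> \<in> space M. \<forall>q\<in>?J. \<omega> \<in> B q} = (\<Prod>q\<in>?J. prob (B q))"
  proof (rule source_alg_indep[where K = K])
    show "disjoint_family_on K ?J" by (auto simp: disjoint_family_on_def K_def split: option.splits)
    show "K q \<subseteq> sources" if "q \<in> ?J" for q using that J(2) by (auto simp: K_def sources_def)
    show "finite ?J" using J by simp
    show "B q \<in> sets (source_alg (K q))" if "q \<in> ?J" for q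
    proof (cases q)
      case None
      then show ?thesis using A by (simp add: B_def K_def gap_alg_def)
    next
      case (Some p)
      have "val (fst p) (snd p) \<in> measurable (source_alg {Inr p}) (count_space UNIV)"
        by (rule val_measurable_alg) simp
      from measurable_sets[OF this, of "{a p}"] show ?thesis
        using Some by (simp add: B_def K_def vimage_def Int_def conj_commute)
    qed
  qed
  also have "\<dots> = prob A * (\<Prod>p\<in>J. prob (B (Some p)))"
    using J(1) by (subst prod.insert) (auto simp: prod.reindex B_def)
  also have "(\<Prod>p\<in>J. prob (B (Some p))) = (\<Prod>p\<in>J. 1 / 2)"
    using J(2,3) by (intro prod.cong refl) (simp only: B_def option.case, intro prob_val, auto)
  also have "{\<omega> \<in> space M. \<forall>q\<in>?J. \<omega> \<in> B q} = {\<omega> \<in> A. \<forall>p\<in>J. val (fst p) (snd p) \<omega> = a p}"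
    using sets.sets_into_space[of A gap_alg] A by (auto simp: B_def)
  finally show ?thesis by (simp add: power_one_over)
qed

text \<open>Total probability over a countable variable; used to replace random draw indices by
  fixed ones.\<close>

lemma prob_partition:
  fixes X :: "'a \<Rightarrow> 'b :: countable"
  assumes "B \<in> events" "C \<in> events" "\<And>k. {\<omega> \<in> space M. X \<omega> = k} \<in> events"
    and eq: "\<And>k. prob {\<omega> \<in> B. X \<omega> = k} = c * prob {\<omega> \<in> C. X \<omega> = k}"
  shows "prob B = c * prob C"
proof -
  have sums: "(\<lambda>i. prob {\<omega> \<in> D. to_nat (X \<omega>) = i}) sums prob D" if D: "D \<in> events" for D
  proof -
    have "{\<omega> \<in> D. to_nat (X \<omega>) = i} \<in> events" for i
    proof (cases "i \<in> range (to_nat :: 'b \<Rightarrow> nat)")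
      case True
      then obtain k :: 'b where "i = to_nat k" by auto
      then have "{\<omega> \<in> D. to_nat (X \<omega>) = i} = D \<inter> {\<omega> \<in> space M. X \<omega> = k}"
        using sets.sets_into_space[OF D] by auto
      then show ?thesis using assms(3) D by auto
    next
      case False
      then have "{\<omega> \<in> D. to_nat (X \<omega>) = i} = {}" by auto
      then show ?thesis by (simp only: sets.empty_sets)
    qed
    then have "(\<lambda>i. prob {\<omega> \<in> D. to_nat (X \<omega>) = i}) sums prob (\<Union>i. {\<omega> \<in> D. to_nat (X \<omega>) = i})"
      by (intro finite_measure_UNION) (auto simp: disjoint_family_on_def)
    moreover have "(\<Union>i. {\<omega> \<in> D. to_nat (X \<omega>) = i}) = D" by auto
    ultimately show ?thesis by simp
  qed
  have "prob {\<omega> \<in> B. to_nat (X \<omega>) = i} = c * prob {\<omega> \<in> C. to_nat (X \<omega>) = i}" for i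
  proof (cases "i \<in> range (to_nat :: 'b \<Rightarrow> nat)")
    case True
    then obtain k :: 'b where "i = to_nat k" by auto
    then show ?thesis using eq[of k] by simp
  next
    case False
    then have "{\<omega> \<in> D. to_nat (X \<omega>) = i} = {}" for D by auto
    then show ?thesis by (metis (no_types, lifting) measure_empty mult_zero_right)
  qed
  with sums[OF assms(1)] sums_mult[OF sums[OF assms(2)], of c] show ?thesis
    using sums_unique2 by auto
qed


lemma sets_fibre: "f \<in> measurable N (count_space UNIV) \<Longrightarrow> {\<omega> \<in> space N. f \<omega> = k} \<in> sets N"
  by measurable

lemma val_index_measurable:
  assumes "N \<in> measurable gap_alg (count_space UNIV)" "z \<in> Z2_even"
  shows "(\<lambda>\<omega>. val z (N \<omega>) \<omega>) \<in> measurable M (count_space UNIV)"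
proof (rule measurable_compose_countable[OF _ measurable_gap_alg[OF assms(1)]])
  fix m
  show "val z m \<in> measurable M (count_space UNIV)"
    by (rule measurable_source_alg[OF _ val_measurable_alg[of z m "{Inr (z, m)}"]]) (auto simp: sources_def assms)
qed

text \<open>The indices are functions of the clocks, so fixing their values is an event of
  \<open>gap_alg\<close>, on which \<open>prob_gap_val\<close> applies. Distinct sites keep the
  pairs of site and index distinct, whatever the indices are.\<close>

lemma prob_vals:
  fixes z :: "nat \<Rightarrow> int \<times> int" and N :: "int \<times> int \<Rightarrow> 'a \<Rightarrow> nat"
  assumes N: "\<And>z. z \<in> Z2_even \<Longrightarrow> N z \<in> measurable gap_alg (count_space UNIV)"
    and z: "\<And>i. i < n \<Longrightarrow> z i \<in> Z2_even" "inj_on z {..<n}" and a: "\<And>i. i < n \<Longrightarrow> a i \<in> {-1,1}"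
  shows "prob {\<omega> \<in> space M. \<forall>i<n. val (z i) (N (z i) \<omega>) \<omega> = a i} = (1 / 2) ^ n"
proof -
  define X where "X = (\<lambda>\<omega>. map (\<lambda>i. N (z i) \<omega>) [0..<n])"
  have X_iff: "X \<omega> = ns \<longleftrightarrow> length ns = n \<and> (\<forall>i<n. N (z i) \<omega> = ns ! i)" for \<omega> ns
    by (auto simp: X_def list_eq_iff_nth_eq)
  have XA: "{\<omega> \<in> space M. X \<omega> = ns} \<in> sets gap_alg" for ns
  proof -
    have "{\<omega> \<in> space gap_alg. length ns = n \<and> (\<forall>i\<in>{..<n}. N (z i) \<omega> = ns ! i)} \<in> sets gap_alg"
      by (intro sets.sets_Collect_conj sets.sets_Collect_const sets.sets_Collect_finite_All sets_fibre N z) auto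
    then show ?thesis by (simp only: X_iff Ball_def lessThan_iff space_gap_alg)
  qed
  let ?B = "{\<omega> \<in> space M. \<forall>i<n. val (z i) (N (z i) \<omega>) \<omega> = a i}"
  have B: "?B \<in> events"
  proof -
    have "{\<omega> \<in> space M. \<forall>i\<in>{..<n}. val (z i) (N (z i) \<omega>) \<omega> = a i} \<in> events"
      by (intro sets.sets_Collect_finite_All sets_fibre val_index_measurable N z) auto
    then show ?thesis by (simp only: Ball_def lessThan_iff)
  qed
  have "prob ?B = (1 / 2) ^ n * prob (space M)"
  proof (rule prob_partition[where X = X])
    fix ns
    show "{\<omega> \<in> space M. X \<omega> = ns} \<in> events" using XA gap_alg_subset by auto
    show "prob {\<omega> \<in> ?B. X \<omega> = ns} = (1 / 2) ^ n * prob {\<omega> \<in> space M. X \<omega> = ns}"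
    proof (cases "length ns = n")
      case True
      let ?p = "\<lambda>i. (z i, ns ! i)" and ?A = "{\<omega> \<in> space M. X \<omega> = ns}"
      let ?b = "\<lambda>p. a (inv_into {..<n} z (fst p))"
      have inj: "inj_on ?p {..<n}" using z(2) by (auto simp: inj_on_def)
      have "{\<omega> \<in> ?B. X \<omega> = ns} = {\<omega> \<in> ?A. \<forall>p\<in>?p ` {..<n}. val (fst p) (snd p) \<omega> = ?b p}"
        using z(2) by (auto simp: X_iff)
      also have "prob \<dots> = prob ?A * (1 / 2) ^ card (?p ` {..<n})"
      proof (rule prob_gap_val[OF XA])
        show "?b p \<in> {-1,1}" if p: "p \<in> ?p ` {..<n}" for p
        proof -
          obtain i where "p = ?p i" "i < n" using p by auto
          then show ?thesis using a[of i] z(2) by (simp add: inv_into_f_f)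
        qed
      qed (use z(1) in auto)
      finally show ?thesis using card_image[OF inj] by simp
    next
      case False
      then have "{\<omega> \<in> ?B. X \<omega> = ns} = {}" "{\<omega> \<in> space M. X \<omega> = ns} = {}" by (auto simp: X_iff)
      then show ?thesis by (simp only: measure_empty mult_zero_right)
    qed
  qed (rule B, rule sets.top)
  then show ?thesis by (simp add: prob_space)
qed

lemma step_list_sets:
  assumes "\<And>z. z \<in> Z2_even \<Longrightarrow> (\<lambda>\<omega>. \<xi> \<omega> z) \<in> measurable M (count_space UNIV)"
    and "set as \<subseteq> {-1,1}"
  shows "{\<omega> \<in> space M. step_list (\<xi> \<omega>) n = as} \<in> events"
proof (cases "length as = n")
  case True
  have "{\<omega> \<in> space M. \<forall>i\<in>{..<n}. \<xi> \<omega> (sum_list (take i as), int i) = as ! i} \<in> events"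
    using True by (intro sets.sets_Collect_finite_All sets_fibre assms(1) sum_list_even_site[OF assms(2)]) auto
  then show ?thesis by (simp only: step_list_eq_iff True Ball_def lessThan_iff simp_thms)
qed (simp add: step_list_eq_iff)

lemma step_list_pred:
  assumes "\<And>z. z \<in> Z2_even \<Longrightarrow> (\<lambda>\<omega>. \<xi> \<omega> z) \<in> measurable M (count_space UNIV)"
    and r: "\<And>\<omega> z. \<omega> \<in> space M \<Longrightarrow> z \<in> Z2_even \<Longrightarrow> \<xi> \<omega> z \<in> {-1,1}"
  shows "{\<omega> \<in> space M. P (step_list (\<xi> \<omega>) n)} \<in> events"
proof -
  let ?L = "{as. length as = n \<and> set as \<subseteq> {-1,1 :: int}}"
  have rng: "set (step_list (\<xi> \<omega>) n) \<subseteq> {-1,1}" if "\<omega> \<in> space M" for \<omega>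
    by (rule step_list_range) (rule r[OF that])
  have "{\<omega> \<in> space M. P (step_list (\<xi> \<omega>) n)} = (\<Union>as\<in>{as \<in> ?L. P as}. {\<omega> \<in> space M. step_list (\<xi> \<omega>) n = as})"
    using rng by auto
  also have "\<dots> \<in> events"
    by (intro sets.finite_UN step_list_sets assms finite_subset[OF _ finite_step_lists[of n]]) auto
  finally show ?thesis .
qed

text \<open>The indices may be read off all clocks at once: given the clocks, the values at distinct sites
  are still independent. This covers both a fixed dynamical time and the left limit at a ring.\<close>

lemma prob_step_list:
  assumes N: "\<And>z. z \<in> Z2_even \<Longrightarrow> N z \<in> measurable gap_alg (count_space UNIV)"
    and as: "length as = n" "set as \<subseteq> {-1,1}"
  shows "prob {\<omega> \<in> space M. step_list (\<lambda>z. val z (N z \<omega>) \<omega>) n = as} = (1 / 2) ^ n"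
proof -
  have "prob {\<omega> \<in> space M. step_list (\<lambda>z. val z (N z \<omega>) \<omega>) n = as} =
    prob {\<omega> \<in> space M. \<forall>i<n. val (sum_list (take i as), int i) (N (sum_list (take i as), int i) \<omega>) \<omega> = as ! i}"
    by (simp add: step_list_eq_iff as)
  also have "\<dots> = (1 / 2) ^ n"
  proof (rule prob_vals[where z = "\<lambda>i. (sum_list (take i as), int i)"])
    show "as ! i \<in> {-1,1}" if "i < n" for i using that as nth_mem[of i as] by (simp del: nth_mem add: subset_iff)
  qed (use N sum_list_even_site[OF as(2)] as in \<open>auto simp: inj_on_def\<close>)
  finally show ?thesis .
qed

lemma prob_step_list_pred:
  assumes N: "\<And>z. z \<in> Z2_even \<Longrightarrow> N z \<in> measurable gap_alg (count_space UNIV)"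
  shows "prob {\<omega> \<in> space M. P (step_list (\<lambda>z. val z (N z \<omega>) \<omega>) n)} = walk_avg n (\<lambda>as. of_bool (P as))"
proof -
  let ?L = "{as. length as = n \<and> set as \<subseteq> {-1,1 :: int}}" and ?s = "\<lambda>\<omega>. step_list (\<lambda>z. val z (N z \<omega>) \<omega>) n"
  have rng: "set (?s \<omega>) \<subseteq> {-1,1}" if "\<omega> \<in> space M" for \<omega>
    by (rule step_list_range) (rule val_range[OF _ that])
  have ev: "{\<omega> \<in> space M. ?s \<omega> = as} \<in> events" if "as \<in> ?L" for as
    by (rule step_list_sets) (use that in \<open>auto intro: val_index_measurable N\<close>)
  have "{\<omega> \<in> space M. P (?s \<omega>)} = (\<Union>as\<in>{as \<in> ?L. P as}. {\<omega> \<in> space M. ?s \<omega> = as})"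
    using rng by auto
  also have "prob \<dots> = (\<Sum>as\<in>{as \<in> ?L. P as}. prob {\<omega> \<in> space M. ?s \<omega> = as})"
    using ev by (intro finite_measure_finite_Union finite_subset[OF _ finite_step_lists[of n]])
      (auto simp: disjoint_family_on_def)
  also have "\<dots> = (\<Sum>as\<in>{as \<in> ?L. P as}. 1 / 2 ^ n)"
    by (intro sum.cong refl) (simp add: prob_step_list[OF N] power_one_over)
  also have "\<dots> = (\<Sum>as\<in>?L. of_bool (P as)) / 2 ^ n"
    unfolding sum_divide_distrib sum.inter_filter[OF finite_step_lists] by (intro sum.cong) auto
  finally show ?thesis by (simp add: walk_avg_eq_sum)
qed

lemma expectation_step_list:
  assumes N: "\<And>z. z \<in> Z2_even \<Longrightarrow> N z \<in> measurable gap_alg (count_space UNIV)"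
  shows "expectation (\<lambda>\<omega>. F (step_list (\<lambda>z. val z (N z \<omega>) \<omega>) n)) = walk_avg n F"
proof -
  let ?L = "{as. length as = n \<and> set as \<subseteq> {-1,1 :: int}}" and ?s = "\<lambda>\<omega>. step_list (\<lambda>z. val z (N z \<omega>) \<omega>) n"
  have rng: "set (?s \<omega>) \<subseteq> {-1,1}" if "\<omega> \<in> space M" for \<omega>
    by (rule step_list_range) (rule val_range[OF _ that])
  have ev: "{\<omega> \<in> space M. ?s \<omega> = as} \<in> events" if "as \<in> ?L" for as
    by (rule step_list_sets) (use that in \<open>auto intro: val_index_measurable N\<close>)
  have "expectation (\<lambda>\<omega>. F (?s \<omega>)) =
      expectation (\<lambda>\<omega>. \<Sum>as\<in>?L. F as * indicator {\<omega> \<in> space M. ?s \<omega> = as} \<omega>)"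
  proof (rule Bochner_Integration.integral_cong[OF refl])
    fix \<omega> assume "\<omega> \<in> space M"
    then have "(\<Sum>as\<in>?L. F as * indicator {\<omega> \<in> space M. ?s \<omega> = as} \<omega>) = (\<Sum>as\<in>?L. if as = ?s \<omega> then F as else 0)"
      by (intro sum.cong) auto
    also have "\<dots> = F (?s \<omega>)"
      using finite_step_lists[of n] rng[OF \<open>\<omega> \<in> space M\<close>] by (subst sum.delta) auto
    finally show "F (?s \<omega>) = (\<Sum>as\<in>?L. F as * indicator {\<omega> \<in> space M. ?s \<omega> = as} \<omega>)" ..
  qed
  also have "\<dots> = (\<Sum>as\<in>?L. F as * prob {\<omega> \<in> space M. ?s \<omega> = as})"
    using ev by (subst Bochner_Integration.integral_sum)
      (auto intro!: sum.cong integrable_real_indicator simp: emeasure_eq_measure)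
  also have "\<dots> = (\<Sum>as\<in>?L. F as * (1 / 2) ^ n)"
    by (intro sum.cong refl arg_cong2[where f = "(*)"] prob_step_list[OF N]) auto
  finally show ?thesis by (simp add: walk_avg_eq_sum power_one_over sum_divide_distrib)
qed

lemma num_rings_measurable_alg:
  assumes "\<And>n. Inl (z, n) \<in> K"
  shows "num_rings gap z \<tau> \<in> measurable (source_alg K) (count_space UNIV)"
proof -
  have [measurable]: "gap z n \<in> borel_measurable (source_alg K)" for n
    using assms by (intro gap_measurable_alg)
  show ?thesis unfolding num_rings_def[abs_def] ring_time_def by measurable
qed

lemma num_rings_measurable: "z \<in> Z2_even \<Longrightarrow> num_rings gap z \<tau> \<in> measurable gap_alg (count_space UNIV)"
  unfolding gap_alg_def by (rule num_rings_measurable_alg) auto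

text \<open>On \<open>C\<close> both arrows are the same draw, which gives
  \<open>of_bool (a = b) / 2\<close>. Off \<open>C\<close> they are two different draws, by site or
  by index, which gives 1/4. For \<open>x \<noteq> y\<close> the event \<open>C\<close> is
  empty.\<close>

lemma prob_pair_site:
  assumes z: "(x, t) \<in> Z2_even" "(y, t) \<in> Z2_even" and ab: "a \<in> {-1,1}" "b \<in> {-1,1}"
    and r: "r x = prob {\<omega> \<in> space M. num_rings gap (x, t) \<sigma> \<omega> = num_rings gap (x, t) \<tau> \<omega>}"
  shows "prob {\<omega> \<in> space M. arrow gap val (x, t) \<sigma> \<omega> = a \<and> arrow gap val (y, t) \<tau> \<omega> = b} = pair_weight r x y a b"
proof -
  let ?N1 = "num_rings gap (x, t) \<sigma>" and ?N2 = "num_rings gap (y, t) \<tau>"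
  let ?v1 = "\<lambda>\<omega>. val (x, t) (?N1 \<omega>) \<omega>" and ?v2 = "\<lambda>\<omega>. val (y, t) (?N2 \<omega>) \<omega>"
  define C where "C = {\<omega> \<in> space M. x = y \<and> ?N1 \<omega> = ?N2 \<omega>}"
  note N = num_rings_measurable[OF z(1), of \<sigma>] num_rings_measurable[OF z(2), of \<tau>]
  have [measurable]: "?N1 \<in> measurable gap_alg (count_space UNIV)" "?N2 \<in> measurable gap_alg (count_space UNIV)"
    by (fact N)+
  have [measurable]: "?v1 \<in> measurable M (count_space UNIV)" "?v2 \<in> measurable M (count_space UNIV)"
    by (intro val_index_measurable N z)+
  have [measurable]: "?N1 \<in> measurable M (count_space UNIV)" "?N2 \<in> measurable M (count_space UNIV)"
    by (intro measurable_gap_alg N)+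
  have Cg: "C \<in> sets gap_alg"
  proof -
    have "C = (if x = y then \<Union>n. {\<omega> \<in> space gap_alg. ?N1 \<omega> = n} \<inter> {\<omega> \<in> space gap_alg. ?N2 \<omega> = n} else {})"
      by (auto simp: C_def)
    also have "\<dots> \<in> sets gap_alg"
      using sets_fibre[OF N(1)] sets_fibre[OF N(2)] by (auto intro!: sets.countable_UN)
    finally show ?thesis .
  qed
  have C [measurable]: "C \<in> events" using Cg gap_alg_subset by auto
  have X: "{\<omega> \<in> space M. (?N1 \<omega>, ?N2 \<omega>) = k} \<in> sets gap_alg" for k
  proof -
    have "{\<omega> \<in> space gap_alg. ?N1 \<omega> = fst k \<and> ?N2 \<omega> = snd k} \<in> sets gap_alg" by measurable
    then show ?thesis by (simp add: prod_eq_iff)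
  qed
  have XM: "{\<omega> \<in> space M. (?N1 \<omega>, ?N2 \<omega>) = k} \<in> events" for k
    using X[of k] gap_alg_subset by auto
  have same: "prob {\<omega> \<in> C. ?v1 \<omega> = a \<and> ?v2 \<omega> = b} = of_bool (a = b) / 2 * prob C"
  proof (rule prob_partition[where X = "\<lambda>\<omega>. (?N1 \<omega>, ?N2 \<omega>)"])
    have "C \<inter> {\<omega> \<in> space M. ?v1 \<omega> = a \<and> ?v2 \<omega> = b} \<in> events" by measurable
    moreover have "C \<inter> {\<omega> \<in> space M. ?v1 \<omega> = a \<and> ?v2 \<omega> = b} = {\<omega> \<in> C. ?v1 \<omega> = a \<and> ?v2 \<omega> = b}"
      by (auto simp: C_def)
    ultimately show "{\<omega> \<in> C. ?v1 \<omega> = a \<and> ?v2 \<omega> = b} \<in> events" by simp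
    fix k :: "nat \<times> nat"
    let ?A = "{\<omega> \<in> C. (?N1 \<omega>, ?N2 \<omega>) = k}"
    have A: "?A = C \<inter> {\<omega> \<in> space M. (?N1 \<omega>, ?N2 \<omega>) = k}" by (auto simp: C_def)
    have Ag: "?A \<in> sets gap_alg" unfolding A by (rule sets.Int[OF Cg X])
    show "prob {\<omega> \<in> {\<omega> \<in> C. ?v1 \<omega> = a \<and> ?v2 \<omega> = b}. (?N1 \<omega>, ?N2 \<omega>) = k} = of_bool (a = b) / 2 * prob ?A"
    proof (cases "a = b \<and> x = y")
      case True
      have "prob {\<omega> \<in> ?A. \<forall>p\<in>{((x, t), fst k)}. val (fst p) (snd p) \<omega> = a} = prob ?A * (1 / 2) ^ card {((x, t), fst k)}"
        by (rule prob_gap_val[OF Ag]) (use z ab in auto)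
      moreover have "{\<omega> \<in> ?A. \<forall>p\<in>{((x, t), fst k)}. val (fst p) (snd p) \<omega> = a} =
          {\<omega> \<in> {\<omega> \<in> C. ?v1 \<omega> = a \<and> ?v2 \<omega> = b}. (?N1 \<omega>, ?N2 \<omega>) = k}"
      proof -
        have "\<omega> \<in> ?A \<and> val (x, t) (fst k) \<omega> = a \<longleftrightarrow>
            (\<omega> \<in> C \<and> ?v1 \<omega> = a \<and> ?v2 \<omega> = b) \<and> (?N1 \<omega>, ?N2 \<omega>) = k" for \<omega>
        proof (cases "\<omega> \<in> C \<and> (?N1 \<omega>, ?N2 \<omega>) = k")
          case in_C: True
          then have "fst k = ?N1 \<omega>" by (metis fst_conv)
          moreover have "?v2 \<omega> = ?v1 \<omega>" using in_C True unfolding C_def by (metis (mono_tags, lifting) mem_Collect_eq)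
          ultimately show ?thesis using in_C True by (simp only: mem_Collect_eq) blast
        qed blast
        then show ?thesis by simp
      qed
      ultimately show ?thesis using True by simp
    next
      case False
      then have "{\<omega> \<in> {\<omega> \<in> C. ?v1 \<omega> = a \<and> ?v2 \<omega> = b}. (?N1 \<omega>, ?N2 \<omega>) = k} = {}"
        and "a = b \<Longrightarrow> C = {}" by (auto simp: C_def)
      then show ?thesis by (cases "a = b") (simp, simp only: measure_empty, simp)
    qed
  qed (use XM C in auto)
  have different: "prob {\<omega> \<in> space M - C. ?v1 \<omega> = a \<and> ?v2 \<omega> = b} = 1 / 4 * prob (space M - C)"
  proof (rule prob_partition[where X = "\<lambda>\<omega>. (?N1 \<omega>, ?N2 \<omega>)"])
    have "(space M - C) \<inter> {\<omega> \<in> space M. ?v1 \<omega> = a \<and> ?v2 \<omega> = b} \<in> events" by measurable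
    moreover have "(space M - C) \<inter> {\<omega> \<in> space M. ?v1 \<omega> = a \<and> ?v2 \<omega> = b} = {\<omega> \<in> space M - C. ?v1 \<omega> = a \<and> ?v2 \<omega> = b}"
      by auto
    ultimately show "{\<omega> \<in> space M - C. ?v1 \<omega> = a \<and> ?v2 \<omega> = b} \<in> events" by simp
    fix k :: "nat \<times> nat"
    let ?A = "{\<omega> \<in> space M - C. (?N1 \<omega>, ?N2 \<omega>) = k}"
    have A: "?A = (space gap_alg - C) \<inter> {\<omega> \<in> space M. (?N1 \<omega>, ?N2 \<omega>) = k}" by auto
    have Ag: "?A \<in> sets gap_alg" unfolding A by (intro sets.Int sets.compl_sets Cg X)
    show "prob {\<omega> \<in> {\<omega> \<in> space M - C. ?v1 \<omega> = a \<and> ?v2 \<omega> = b}. (?N1 \<omega>, ?N2 \<omega>) = k} = 1 / 4 * prob ?A"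
    proof (cases "((x, t), fst k) = ((y, t), snd k)")
      case False
      let ?J = "{((x, t), fst k), ((y, t), snd k)}" and ?c = "\<lambda>p. if p = ((x, t), fst k) then a else b"
      have "prob {\<omega> \<in> ?A. \<forall>p\<in>?J. val (fst p) (snd p) \<omega> = ?c p} = prob ?A * (1 / 2) ^ card ?J"
        by (rule prob_gap_val[OF Ag]) (use z ab in auto)
      moreover have "{\<omega> \<in> ?A. \<forall>p\<in>?J. val (fst p) (snd p) \<omega> = ?c p} =
          {\<omega> \<in> {\<omega> \<in> space M - C. ?v1 \<omega> = a \<and> ?v2 \<omega> = b}. (?N1 \<omega>, ?N2 \<omega>) = k}"
      proof -
        have "\<omega> \<in> ?A \<and> (\<forall>p\<in>?J. val (fst p) (snd p) \<omega> = ?c p) \<longleftrightarrow>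
            (\<omega> \<in> space M - C \<and> ?v1 \<omega> = a \<and> ?v2 \<omega> = b) \<and> (?N1 \<omega>, ?N2 \<omega>) = k" for \<omega>
        proof (cases "\<omega> \<in> space M - C \<and> (?N1 \<omega>, ?N2 \<omega>) = k")
          case True
          then have "fst k = ?N1 \<omega>" "snd k = ?N2 \<omega>" by (metis fst_conv, metis snd_conv)
          moreover have "(\<forall>p\<in>?J. val (fst p) (snd p) \<omega> = ?c p) \<longleftrightarrow>
              val (x, t) (fst k) \<omega> = a \<and> val (y, t) (snd k) \<omega> = b"
            using False by auto
          ultimately show ?thesis using True by (simp only: mem_Collect_eq) blast
        qed blast
        then show ?thesis by simp
      qed
      moreover have "card ?J = 2" using False by simp
      ultimately show ?thesis by (simp add: power2_eq_square)
    next
      case True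
      then have "{\<omega> \<in> {\<omega> \<in> space M - C. ?v1 \<omega> = a \<and> ?v2 \<omega> = b}. (?N1 \<omega>, ?N2 \<omega>) = k} = {}" "?A = {}"
        by (auto simp: C_def)
      then show ?thesis by (simp only: measure_empty mult_zero_right)
    qed
  qed (use XM C in auto)
  have "prob {\<omega> \<in> space M. ?v1 \<omega> = a \<and> ?v2 \<omega> = b} =
      prob ({\<omega> \<in> C. ?v1 \<omega> = a \<and> ?v2 \<omega> = b} \<union> {\<omega> \<in> space M - C. ?v1 \<omega> = a \<and> ?v2 \<omega> = b})"
    by (rule arg_cong[where f = prob]) (auto simp: C_def)
  also have "\<dots> = prob {\<omega> \<in> C. ?v1 \<omega> = a \<and> ?v2 \<omega> = b} + prob {\<omega> \<in> space M - C. ?v1 \<omega> = a \<and> ?v2 \<omega> = b}"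
  proof (rule finite_measure_Union)
    have "{\<omega> \<in> C. ?v1 \<omega> = a \<and> ?v2 \<omega> = b} = C \<inter> {\<omega> \<in> space M. ?v1 \<omega> = a \<and> ?v2 \<omega> = b}"
      by (auto simp: C_def)
    also have "\<dots> \<in> events" by measurable
    finally show "{\<omega> \<in> C. ?v1 \<omega> = a \<and> ?v2 \<omega> = b} \<in> events" .
    have "{\<omega> \<in> space M - C. ?v1 \<omega> = a \<and> ?v2 \<omega> = b} = (space M - C) \<inter> {\<omega> \<in> space M. ?v1 \<omega> = a \<and> ?v2 \<omega> = b}"
      by auto
    also have "\<dots> \<in> events" by measurable
    finally show "{\<omega> \<in> space M - C. ?v1 \<omega> = a \<and> ?v2 \<omega> = b} \<in> events" .
  qed auto
  also have "\<dots> = of_bool (a = b) / 2 * prob C + 1 / 4 * (1 - prob C)"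
    unfolding same different using C by (simp add: prob_compl)
  also have "\<dots> = pair_weight r x y a b"
  proof (cases "x = y")
    case True
    then have "prob C = r x" using r by (simp add: C_def)
    then show ?thesis using True ab by (auto simp: pair_weight_def field_simps)
  next
    case False
    then have "C = {}" by (simp add: C_def)
    then show ?thesis using False by (simp add: pair_weight_def)
  qed
  finally show ?thesis by (simp add: arrow_def)
qed


section \<open>The walks at one and at two dynamical times\<close>

abbreviation walk :: "nat \<Rightarrow> real \<Rightarrow> 'a \<Rightarrow> int list" where
  "walk n \<tau> \<omega> \<equiv> step_list (\<lambda>z. arrow gap val z \<tau> \<omega>) n"

lemma arrow_range: "z \<in> Z2_even \<Longrightarrow> \<omega> \<in> space M \<Longrightarrow> arrow gap val z \<tau> \<omega> \<in> {-1,1}"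
  unfolding arrow_def by (rule val_range)

lemma arrow_measurable_alg:
  assumes "\<And>n. Inl (z, n) \<in> K" "\<And>n. Inr (z, n) \<in> K"
  shows "arrow gap val z \<tau> \<in> measurable (source_alg K) (count_space UNIV)"
  unfolding arrow_def[abs_def]
  by (rule measurable_compose_countable[OF val_measurable_alg num_rings_measurable_alg]) (use assms in auto)

lemma arrow_measurable: "z \<in> Z2_even \<Longrightarrow> arrow gap val z \<tau> \<in> measurable M (count_space UNIV)"
  by (rule measurable_source_alg[OF subset_refl arrow_measurable_alg]) (auto simp: sources_def)

lemma walk_range: "\<omega> \<in> space M \<Longrightarrow> set (walk n \<tau> \<omega>) \<subseteq> {-1,1}"
  by (rule step_list_range) (rule arrow_range)

lemma walk_eq_sets: "set as \<subseteq> {-1,1} \<Longrightarrow> {\<omega> \<in> space M. walk n \<tau> \<omega> = as} \<in> events"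
  by (rule step_list_sets) (auto intro: arrow_measurable)

lemma walk_pred_sets: "{\<omega> \<in> space M. P (walk n \<tau> \<omega>)} \<in> events"
  by (rule step_list_pred) (auto intro: arrow_measurable dest: arrow_range)

lemma walk_fun_measurable: "(\<lambda>\<omega>. F (walk n \<tau> \<omega>) :: real) \<in> borel_measurable M"
proof (rule measurableI)
  fix A :: "real set"
  show "(\<lambda>\<omega>. F (walk n \<tau> \<omega>)) -` A \<inter> space M \<in> events"
    using walk_pred_sets[of "\<lambda>as. F as \<in> A" \<tau> n] by (simp add: vimage_def Int_def conj_commute)
qed simp

lemma expectation_walk: "expectation (\<lambda>\<omega>. F (walk n \<tau> \<omega>)) = walk_avg n F"
  unfolding arrow_def by (rule expectation_step_list[OF num_rings_measurable])

text \<open>The value 0 off the even lattice is a default that makes the bounds required of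
  \<open>R\<close> hold at all sites.\<close>

definition same_rings :: "real \<Rightarrow> real \<Rightarrow> nat \<Rightarrow> int \<Rightarrow> real" where
  "same_rings \<sigma> \<tau> t x = (if (x, int t) \<in> Z2_even then
     prob {\<omega> \<in> space M. num_rings gap (x, int t) \<sigma> \<omega> = num_rings gap (x, int t) \<tau> \<omega>} else 0)"

text \<open>Step \<open>i\<close> of both walks uses only sources of the row at time
  \<open>i\<close>. Different rows are disjoint, hence independent, and within a row the two sites
  may coincide.\<close>

lemma prob_pair_walk:
  assumes as: "length as = n" "set as \<subseteq> {-1,1}" and bs: "length bs = n" "set bs \<subseteq> {-1,1}"
  shows "prob {\<omega> \<in> space M. walk n \<sigma> \<omega> = as \<and> walk n \<tau> \<omega> = bs} =
    (\<Prod>i<n. pair_weight (same_rings \<sigma> \<tau> i) (sum_list (take i as)) (sum_list (take i bs)) (as ! i) (bs ! i))"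
proof -
  let ?x = "\<lambda>i. sum_list (take i as)" and ?y = "\<lambda>i. sum_list (take i bs)"
  have even: "(?x i, int i) \<in> Z2_even" "(?y i, int i) \<in> Z2_even" if "i < n" for i
    using sum_list_even_site[OF as(2)] sum_list_even_site[OF bs(2)] that as bs by auto
  have nth: "as ! i \<in> {-1,1}" "bs ! i \<in> {-1,1}" if "i < n" for i
    using that as bs nth_mem[of i as] nth_mem[of i bs] by (simp_all del: nth_mem add: subset_iff)
  define row where "row i = {p. p \<in> Z2_even \<times> (UNIV :: nat set) \<and> snd (fst p) = int i}" for i
  define K where "K i = row i <+> row i" for i
  define A where "A i = {\<omega> \<in> space M. arrow gap val (?x i, int i) \<sigma> \<omega> = as ! i \<and> arrow gap val (?y i, int i) \<tau> \<omega> = bs ! i}" for i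
  have "prob {\<omega> \<in> space M. \<forall>i\<in>{..<n}. \<omega> \<in> A i} = (\<Prod>i<n. prob (A i))"
  proof (rule source_alg_indep[where K = K])
    show "disjoint_family_on K {..<n}" by (auto simp: disjoint_family_on_def K_def row_def)
    show "K i \<subseteq> sources" for i by (auto simp: K_def row_def sources_def)
    show "A i \<in> sets (source_alg (K i))" if "i \<in> {..<n}" for i
    proof -
      have "{\<omega> \<in> space (source_alg (K i)). arrow gap val (?x i, int i) \<sigma> \<omega> = as ! i} \<in> sets (source_alg (K i))"
        "{\<omega> \<in> space (source_alg (K i)). arrow gap val (?y i, int i) \<tau> \<omega> = bs ! i} \<in> sets (source_alg (K i))"
        by (intro sets_fibre arrow_measurable_alg; use even that in \<open>auto simp: K_def row_def\<close>)+
      from sets.Int[OF this] show ?thesis by (simp add: A_def Int_def conj_commute conj_left_commute)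
    qed
  qed simp
  also have "\<dots> = (\<Prod>i<n. pair_weight (same_rings \<sigma> \<tau> i) (?x i) (?y i) (as ! i) (bs ! i))"
    unfolding A_def by (intro prod.cong refl prob_pair_site) (use even nth in \<open>auto simp: same_rings_def\<close>)
  also have "{\<omega> \<in> space M. \<forall>i\<in>{..<n}. \<omega> \<in> A i} = {\<omega> \<in> space M. walk n \<sigma> \<omega> = as \<and> walk n \<tau> \<omega> = bs}"
    using as bs by (auto simp: A_def step_list_eq_iff)
  finally show ?thesis .
qed

lemma expectation_pair_walk:
  "expectation (\<lambda>\<omega>. F (walk n \<sigma> \<omega>) * G (walk n \<tau> \<omega>)) =
    pair_avg n (same_rings \<sigma> \<tau>) 0 0 0 (\<lambda>as bs. F as * G bs)"
proof -
  let ?L = "{as. length as = n \<and> set as \<subseteq> {-1,1 :: int}}"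
  let ?E = "\<lambda>as bs. {\<omega> \<in> space M. walk n \<sigma> \<omega> = as \<and> walk n \<tau> \<omega> = bs}"
  have ev: "?E as bs \<in> events" if "as \<in> ?L" "bs \<in> ?L" for as bs
  proof -
    have "?E as bs = {\<omega> \<in> space M. walk n \<sigma> \<omega> = as} \<inter> {\<omega> \<in> space M. walk n \<tau> \<omega> = bs}" by auto
    also have "\<dots> \<in> events" using that by (intro sets.Int walk_eq_sets) auto
    finally show ?thesis .
  qed
  have ind: "integrable M (indicat_real (?E as bs))" if "as \<in> ?L" "bs \<in> ?L" for as bs
    using ev[OF that] by (intro integrable_real_indicator) (auto simp: emeasure_eq_measure)
  have "expectation (\<lambda>\<omega>. F (walk n \<sigma> \<omega>) * G (walk n \<tau> \<omega>)) =
      expectation (\<lambda>\<omega>. \<Sum>as\<in>?L. \<Sum>bs\<in>?L. (F as * G bs) * indicat_real (?E as bs) \<omega>)"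
  proof (rule Bochner_Integration.integral_cong[OF refl])
    fix \<omega> assume \<omega>: "\<omega> \<in> space M"
    have "(\<Sum>as\<in>?L. \<Sum>bs\<in>?L. (F as * G bs) * indicat_real (?E as bs) \<omega>) =
        (\<Sum>as\<in>?L. \<Sum>bs\<in>?L. (if as = walk n \<sigma> \<omega> then F as else 0) * (if bs = walk n \<tau> \<omega> then G bs else 0))"
      using \<omega> by (intro sum.cong refl) auto
    also have "\<dots> = (\<Sum>as\<in>?L. if as = walk n \<sigma> \<omega> then F as else 0) * (\<Sum>bs\<in>?L. if bs = walk n \<tau> \<omega> then G bs else 0)"
      by (simp only: sum_product)
    also have "\<dots> = F (walk n \<sigma> \<omega>) * G (walk n \<tau> \<omega>)"
      using finite_step_lists[of n] walk_range[OF \<omega>] by (simp add: sum.delta)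
    finally show "F (walk n \<sigma> \<omega>) * G (walk n \<tau> \<omega>) = (\<Sum>as\<in>?L. \<Sum>bs\<in>?L. (F as * G bs) * indicat_real (?E as bs) \<omega>)" ..
  qed
  also have "\<dots> = (\<Sum>as\<in>?L. \<Sum>bs\<in>?L. expectation (\<lambda>\<omega>. (F as * G bs) * indicat_real (?E as bs) \<omega>))"
    using ind by (subst Bochner_Integration.integral_sum; intro sum.cong refl Bochner_Integration.integral_sum
      Bochner_Integration.integrable_sum integrable_mult_right) auto
  also have "\<dots> = (\<Sum>as\<in>?L. \<Sum>bs\<in>?L. (\<Prod>i<n. pair_weight (same_rings \<sigma> \<tau> (0 + i)) (0 + sum_list (take i as))
      (0 + sum_list (take i bs)) (as ! i) (bs ! i)) * (F as * G bs))"
  proof (intro sum.cong refl)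
    fix as bs assume L: "as \<in> ?L" "bs \<in> ?L"
    have "expectation (\<lambda>\<omega>. (F as * G bs) * indicat_real (?E as bs) \<omega>) = (F as * G bs) * prob (?E as bs)"
      using ev[OF L] by simp
    also have "prob (?E as bs) = (\<Prod>i<n. pair_weight (same_rings \<sigma> \<tau> i) (sum_list (take i as))
      (sum_list (take i bs)) (as ! i) (bs ! i))"
      using L by (intro prob_pair_walk) auto
    finally show "expectation (\<lambda>\<omega>. (F as * G bs) * indicat_real (?E as bs) \<omega>) =
       (\<Prod>i<n. pair_weight (same_rings \<sigma> \<tau> (0 + i)) (0 + sum_list (take i as))
      (0 + sum_list (take i bs)) (as ! i) (bs ! i)) * (F as * G bs)" by simp
  qed
  finally show ?thesis unfolding pair_avg_eq_sum .
qed

section \<open>Almost sure regularity of the clocks\<close>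

lemma AE_gap_pos: "z \<in> Z2_even \<Longrightarrow> AE \<omega> in M. 0 < gap z n \<omega>"
proof -
  assume z: "z \<in> Z2_even"
  have [measurable]: "gap z n \<in> borel_measurable M"
    using gap_exponential[OF z] by (auto simp: distributed_def)
  have "prob {\<omega> \<in> space M. 0 < gap z n \<omega>} = 1"
    using exponential_distributedD_gt[OF gap_exponential[OF z], of 0] by simp
  then show ?thesis by (rule AE_prob_1[THEN AE_mp]) auto
qed

lemma prob_all_gaps_le:
  assumes z: "z \<in> Z2_even" and B: "0 \<le> B"
  shows "prob {\<omega> \<in> space M. \<forall>n<m. gap z n \<omega> \<le> B} = (1 - exp (- B)) ^ m"
proof -
  have "prob {\<omega> \<in> space M. \<forall>n\<in>{..<m}. \<omega> \<in> {\<omega> \<in> space M. gap z n \<omega> \<le> B}} =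
    (\<Prod>n<m. prob {\<omega> \<in> space M. gap z n \<omega> \<le> B})"
  proof (rule source_alg_indep[where K = "\<lambda>n. {Inl (z, n)}"])
    fix n
    have [measurable]: "gap z n \<in> borel_measurable (source_alg {Inl (z, n)})"
      by (rule gap_measurable_alg) simp
    have "{\<omega> \<in> space (source_alg {Inl (z, n)}). gap z n \<omega> \<le> B} \<in> sets (source_alg {Inl (z, n)})"
      by measurable
    then show "{\<omega> \<in> space M. gap z n \<omega> \<le> B} \<in> sets (source_alg {Inl (z, n)})" by simp
  qed (use z in \<open>auto simp: disjoint_family_on_def sources_def\<close>)
  also have "\<dots> = (1 - exp (- B)) ^ m"
    using exponential_distributedD_le[OF gap_exponential[OF z] B] by simp
  finally show ?thesis by (simp add: Ball_def conj_commute cong: conj_cong)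
qed

text \<open>Independent gaps stay below a fixed level with geometrically small probability. With
  positive gaps, one large gap pushes all later rings beyond the level, so no law of large numbers
  is used.\<close>

lemma AE_gap_large:
  assumes z: "z \<in> Z2_even"
  shows "AE \<omega> in M. \<exists>n. real B < gap z n \<omega>"
proof -
  have [measurable]: "gap z n \<in> borel_measurable M" for n
    using gap_exponential[OF z] by (auto simp: distributed_def)
  let ?A = "{\<omega> \<in> space M. \<forall>n. gap z n \<omega> \<le> real B}"
  have "prob ?A = 0"
  proof (rule ccontr)
    assume "prob ?A \<noteq> 0"
    then have "0 < prob ?A" by (simp add: measure_le_0_iff less_le)
    then obtain m where m: "(1 - exp (- real B)) ^ m < prob ?A"
      using real_arch_pow_inv[of "prob ?A" "1 - exp (- real B)"] by auto
    have "prob ?A \<le> prob {\<omega> \<in> space M. \<forall>n<m. gap z n \<omega> \<le> real B}"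
      by (rule finite_measure_mono) auto
    with m prob_all_gaps_le[OF z, of "real B" m] show False by simp
  qed
  moreover have "?A \<in> events" by measurable
  ultimately have "AE \<omega> in M. \<omega> \<notin> ?A" by (simp only: prob_eq_0)
  then show ?thesis by (rule AE_mp) (rule AE_I2, auto simp: not_le)
qed

text \<open>Finiteness matters because \<open>card\<close> of an infinite set is 0, which would
  falsify the count \<open>num_rings\<close>.\<close>

definition regular_clock :: "int \<times> int \<Rightarrow> 'a \<Rightarrow> bool" where
  "regular_clock z \<omega> \<longleftrightarrow> (\<forall>n. 0 < gap z n \<omega>) \<and> (\<forall>\<tau>. finite {n. ring_time gap z n \<omega> \<le> \<tau>})"

lemma ring_time_ge_gap:
  assumes "\<And>n. 0 < gap z n \<omega>" "m \<le> n"
  shows "gap z m \<omega> \<le> ring_time gap z n \<omega>"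
  unfolding ring_time_def using assms by (intro member_le_sum) (auto intro: less_imp_le)

lemma AE_regular_clock:
  assumes z: "z \<in> Z2_even"
  shows "AE \<omega> in M. regular_clock z \<omega>"
proof -
  have "AE \<omega> in M. \<forall>n. 0 < gap z n \<omega>" "AE \<omega> in M. \<forall>B. \<exists>n. real B < gap z n \<omega>"
    using AE_gap_pos[OF z] AE_gap_large[OF z] by (auto simp: AE_all_countable)
  then show ?thesis
  proof eventually_elim
    case (elim \<omega>)
    have "finite {n. ring_time gap z n \<omega> \<le> \<tau>}" for \<tau>
    proof -
      obtain m where "real (nat \<lceil>\<tau>\<rceil>) < gap z m \<omega>" using elim(2) by blast
      then have "\<tau> < gap z m \<omega>" by linarith
      then have "{n. ring_time gap z n \<omega> \<le> \<tau>} \<subseteq> {..<m}"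
        using ring_time_ge_gap[of z \<omega> m] elim(1) by (force simp: not_le[symmetric])
      then show ?thesis by (rule finite_subset) simp
    qed
    then show ?case using elim(1) by (simp add: regular_clock_def)
  qed
qed

text \<open>The slope of the exponential on this range is at least exp(-1), which is at least 1/3.
  This is the origin of \<open>\<theta> / 3\<close> in the decorrelation bounds.\<close>

lemma exp_diff_ge:
  fixes \<sigma> \<tau> :: real
  assumes "\<sigma> \<le> \<tau>" "\<tau> \<le> 1"
  shows "(\<tau> - \<sigma>) / 3 \<le> exp (- \<sigma>) - exp (- \<tau>)"
proof -
  have "1 / 3 \<le> exp (- 1 :: real)" using exp_le by (simp add: exp_minus field_simps)
  also have "\<dots> \<le> exp (- \<tau>)" using assms by simp
  finally have "(\<tau> - \<sigma>) * (1 / 3) \<le> (\<tau> - \<sigma>) * exp (- \<tau>)" using assms by (intro mult_left_mono) auto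
  also have "\<dots> \<le> (exp (\<tau> - \<sigma>) - 1) * exp (- \<tau>)"
    using exp_ge_add_one_self[of "\<tau> - \<sigma>"] by (intro mult_right_mono) (linarith, simp)
  also have "\<dots> = exp (- \<sigma>) - exp (- \<tau>)" by (simp add: algebra_simps flip: exp_add)
  finally show ?thesis by simp
qed

text \<open>If the first ring falls in \<open>(\<sigma>, \<tau>]\<close>, the counts are 0 and
  positive, hence differ. Looking only at the first ring requires just the exponential law of one
  gap.\<close>

lemma same_rings_range:
  assumes "0 \<le> \<sigma>" "\<sigma> \<le> \<tau>" "\<tau> \<le> 1"
  shows "0 \<le> same_rings \<sigma> \<tau> t x" "same_rings \<sigma> \<tau> t x \<le> 1 - (\<tau> - \<sigma>) / 3"
proof -
  show "0 \<le> same_rings \<sigma> \<tau> t x" by (simp add: same_rings_def)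
  show "same_rings \<sigma> \<tau> t x \<le> 1 - (\<tau> - \<sigma>) / 3"
  proof (cases "(x, int t) \<in> Z2_even")
    case z: True
    let ?z = "(x, int t)"
    have [measurable]: "gap ?z n \<in> borel_measurable M" for n
      using gap_exponential[OF z] by (auto simp: distributed_def)
    let ?C = "{\<omega> \<in> space M. \<sigma> < gap ?z 0 \<omega> \<and> gap ?z 0 \<omega> \<le> \<tau>}"
    have "prob ?C = prob ({\<omega> \<in> space M. \<sigma> < gap ?z 0 \<omega>} - {\<omega> \<in> space M. \<tau> < gap ?z 0 \<omega>})"
      by (rule arg_cong[where f = prob]) auto
    also have "\<dots> = prob {\<omega> \<in> space M. \<sigma> < gap ?z 0 \<omega>} - prob {\<omega> \<in> space M. \<tau> < gap ?z 0 \<omega>}"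
      using assms by (intro finite_measure_Diff) auto
    also have "\<dots> = exp (- \<sigma>) - exp (- \<tau>)"
      using exponential_distributedD_gt[OF gap_exponential[OF z], of \<sigma>]
        exponential_distributedD_gt[OF gap_exponential[OF z], of \<tau>] assms by simp
    finally have C: "(\<tau> - \<sigma>) / 3 \<le> prob ?C" using exp_diff_ge assms by simp
    have "AE \<omega> in M. num_rings gap ?z \<sigma> \<omega> = num_rings gap ?z \<tau> \<omega> \<longrightarrow> \<omega> \<notin> ?C"
      using AE_regular_clock[OF z]
    proof eventually_elim
      case (elim \<omega>)
      then have pos: "\<And>n. 0 < gap ?z n \<omega>" and fin: "finite {n. ring_time gap ?z n \<omega> \<le> \<tau>}"
        by (auto simp: regular_clock_def)
      show ?case
      proof (intro impI notI)
        assume eq: "num_rings gap ?z \<sigma> \<omega> = num_rings gap ?z \<tau> \<omega>" and "\<omega> \<in> ?C"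
        then have gap: "\<sigma> < gap ?z 0 \<omega>" "gap ?z 0 \<omega> \<le> \<tau>" by auto
        have "{n. ring_time gap ?z n \<omega> \<le> \<sigma>} = {}"
          using ring_time_ge_gap[of ?z \<omega> 0, OF pos] gap(1) by (auto simp: not_le intro: less_le_trans)
        then have "num_rings gap ?z \<sigma> \<omega> = 0" by (simp add: num_rings_def)
        moreover have "0 \<in> {n. ring_time gap ?z n \<omega> \<le> \<tau>}" using gap(2) by (simp add: ring_time_def)
        then have "num_rings gap ?z \<tau> \<omega> \<noteq> 0" using fin by (auto simp: num_rings_def)
        ultimately show False using eq by simp
      qed
    qed
    then have "prob {\<omega> \<in> space M. num_rings gap ?z \<sigma> \<omega> = num_rings gap ?z \<tau> \<omega>} \<le> prob (space M - ?C)"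
      by (intro finite_measure_mono_AE) auto
    also have "\<dots> = 1 - prob ?C" by (rule prob_compl) measurable
    also have "\<dots> \<le> 1 - (\<tau> - \<sigma>) / 3" using C by linarith
    finally show ?thesis using z by (simp add: same_rings_def)
  qed (use assms in \<open>simp add: same_rings_def\<close>)
qed

end

subsection \<open>Second moment bound\<close>

lemma inverse_sqrt_sum_le: "(\<Sum>d<k. 1 / sqrt (real (Suc d))) \<le> 2 * sqrt (real k)"
proof (induction k)
  case (Suc k)
  have "1 / sqrt (real (Suc k)) \<le> 2 * (sqrt (real (Suc k)) - sqrt (real k))"
  proof -
    have "1 = (sqrt (real (Suc k)) - sqrt (real k)) * (sqrt (real (Suc k)) + sqrt (real k))"
      by (simp add: algebra_simps)
    also have "\<dots> \<le> (sqrt (real (Suc k)) - sqrt (real k)) * (2 * sqrt (real (Suc k)))"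
      by (intro mult_left_mono) auto
    finally show ?thesis by (simp add: field_simps)
  qed
  with Suc show ?case by simp
qed simp

text \<open>The discrete form of the integrability of the inverse square root of the distance of two
  dynamical times.\<close>

lemma inverse_sqrt_dist_sum_le:
  assumes "i < m"
  shows "(\<Sum>j<m. if j = i then 0 else 1 / sqrt \<bar>real i - real j\<bar>) \<le> 4 * sqrt (real m)"
proof -
  let ?f = "\<lambda>j. if j = i then 0 else 1 / sqrt \<bar>real i - real j\<bar>" and ?g = "\<lambda>d. 1 / sqrt (real (Suc d))"
  have "sum ?f {..<m} = sum ?f ({..<i} \<union> {Suc i..<m})"
    by (rule sum.mono_neutral_right) (use assms in auto)
  also have "\<dots> = sum ?f {..<i} + sum ?f {Suc i..<m}"
    by (rule sum.union_disjoint) auto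
  also have "sum ?f {..<i} = (\<Sum>j<i. ?g (i - Suc j))"
    by (intro sum.cong) (auto simp: of_nat_diff)
  also have "\<dots> = sum ?g {..<i}" by (rule sum.nat_diff_reindex)
  also have "sum ?f {Suc i..<m} = sum ?g {..<m - Suc i}"
    by (subst sum.atLeastLessThan_shift_0) (auto simp: atLeast0LessThan intro!: sum.cong)
  also have "sum ?g {..<i} + sum ?g {..<m - Suc i} \<le> 2 * sqrt (real i) + 2 * sqrt (real (m - Suc i))"
    by (intro add_mono inverse_sqrt_sum_le)
  also have "\<dots> \<le> 2 * sqrt (real m) + 2 * sqrt (real m)" using assms by (intro add_mono) auto
  finally show ?thesis by simp
qed

context dynamical_discrete_web
begin

lemma integrable_walk: "integrable M (\<lambda>\<omega>. F (walk n \<sigma> \<omega>) * G (walk n \<tau> \<omega>) :: real)"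
proof (rule integrable_const_bound)
  let ?L = "{as. length as = n \<and> set as \<subseteq> {-1,1 :: int}}"
  let ?B = "(\<Sum>as\<in>?L. \<bar>F as\<bar>) * (\<Sum>bs\<in>?L. \<bar>G bs\<bar>)"
  have "\<bar>F' (walk n \<tau> \<omega>)\<bar> \<le> (\<Sum>as\<in>?L. \<bar>F' as\<bar>)" if "\<omega> \<in> space M" for F' :: "int list \<Rightarrow> real" and \<tau> \<omega>
    using finite_step_lists[of n] walk_range[OF that] by (intro member_le_sum) auto
  then show "AE \<omega> in M. norm (F (walk n \<sigma> \<omega>) * G (walk n \<tau> \<omega>)) \<le> ?B"
    by (intro AE_I2) (auto simp: abs_mult intro!: mult_mono sum_nonneg)
  show "(\<lambda>\<omega>. F (walk n \<sigma> \<omega>) * G (walk n \<tau> \<omega>)) \<in> borel_measurable M"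
    by (intro borel_measurable_times walk_fun_measurable)
qed

text \<open>A finite grid of dynamical times replaces an integral over \<tau>. The grid may depend
  on \<open>n\<close>, but the lower bound does not.\<close>

lemma prob_exceptional_grid:
  fixes n :: nat
  obtains m where "m > 0"
    "1 / (1 + 12 * exp 40) \<le> prob {\<omega> \<in> space M. \<exists>i<m. 0 < block_prod n 0 (walk (block_len n 0) (real i / real m) \<omega>)}"
proof -
  define Q where "Q = (\<Prod>j<n. block_mean j)"
  have Q: "Q > 0" unfolding Q_def using block_mean_ge by (intro prod_pos) (auto intro: less_le_trans[of 0 "1/2"])
  \<comment> \<open>So fine a grid that the diagonal terms, each at most \<open>Q\<close>, are at
    most \<open>Q^2 * m\<close> and hence in total at most the squared mean of
    \<open>X\<close>.\<close>
  obtain m where m: "1 / Q < real m" using reals_Archimedean2 by blast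
  moreover from Q have "0 < 1 / Q" by simp
  ultimately have m0: "m > 0" by linarith
  define c :: real where "c = exp 40"
  define C where "C = 1 + 12 * c"
  have C: "C > 0" by (simp add: C_def c_def add_pos_pos)
  let ?N = "block_len n 0"
  define Y where "Y i \<omega> = block_prod n 0 (walk ?N (real i / real m) \<omega>)" for i \<omega>
  define X where "X \<omega> = (\<Sum>i<m. Y i \<omega>)" for \<omega>
  have Yint: "integrable M (\<lambda>\<omega>. Y i \<omega> * Y j \<omega>)" for i j
    unfolding Y_def by (rule integrable_walk)
  have Yint1: "integrable M (Y i)" for i
    using integrable_walk[where F = "block_prod n 0" and n = ?N and \<sigma> = "real i / real m" and G = "\<lambda>_. 1"] by (simp add: Y_def[abs_def])
  have EY: "expectation (Y i) = Q" for i
    using expectation_walk[where F = "block_prod n 0" and n = ?N and \<tau> = "real i / real m"] walk_avg_block_prod[of n 0]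
    by (simp add: Y_def[abs_def] Q_def)
  have far: "expectation (\<lambda>\<omega>. Y i \<omega> * Y j \<omega>) \<le> Q\<^sup>2 * (c * (sqrt 8 * sqrt m * (1 / sqrt \<bar>real i - real j\<bar>)))"
    if "i < j" "j < m" for i j
  proof -
    define \<theta> where "\<theta> = real j / real m - real i / real m"
    have \<theta>: "0 < \<theta>" "\<theta> \<le> 1" "\<theta> = \<bar>real i - real j\<bar> / real m"
      using that m0 by (auto simp: \<theta>_def field_simps)
    have R: "0 \<le> same_rings (real i / real m) (real j / real m) t x"
      "same_rings (real i / real m) (real j / real m) t x \<le> 1 - \<theta> / 3" for t x
      using that m0 same_rings_range[of "real i / real m" "real j / real m"] by (auto simp: \<theta>_def field_simps)
    have "expectation (\<lambda>\<omega>. Y i \<omega> * Y j \<omega>) \<le> Q\<^sup>2 * (exp 40 * sqrt (8 / \<theta>))"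
      unfolding Y_def expectation_pair_walk Q_def by (rule pair_avg_block_prod_le) (use R \<theta> in auto)
    also have "sqrt (8 / \<theta>) = sqrt 8 * sqrt m * (1 / sqrt \<bar>real i - real j\<bar>)"
      unfolding \<theta>(3) by (simp add: real_sqrt_divide real_sqrt_mult)
    finally show ?thesis by (simp add: c_def)
  qed
  have corr: "expectation (\<lambda>\<omega>. Y i \<omega> * Y j \<omega>) \<le>
      Q\<^sup>2 * ((if j = i then real m else 0) + c * (sqrt 8 * sqrt m * (if j = i then 0 else 1 / sqrt \<bar>real i - real j\<bar>)))"
    if "i < m" "j < m" for i j
  proof -
    consider "i = j" | "i < j" | "j < i" by linarith
    then show ?thesis
    proof cases
      case 1
      have "expectation (\<lambda>\<omega>. Y i \<omega> * Y i \<omega>) \<le> expectation (Y i)"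
        using block_prod_range by (intro integral_mono Yint Yint1) (auto simp: Y_def intro!: mult_left_le)
      also have "\<dots> = Q" by (rule EY)
      also have "\<dots> \<le> Q\<^sup>2 * real m" using m Q by (simp add: field_simps power2_eq_square)
      finally show ?thesis using 1 by simp
    next
      case 2
      with far[of i j] that show ?thesis by simp
    next
      case 3
      with far[of j i] that show ?thesis by (simp add: mult.commute[of "Y j _"] abs_minus_commute)
    qed
  qed
  have "expectation (\<lambda>\<omega>. (X \<omega>)\<^sup>2) = (\<Sum>i<m. \<Sum>j<m. expectation (\<lambda>\<omega>. Y i \<omega> * Y j \<omega>))"
    unfolding X_def power2_eq_square sum_product
    by (subst Bochner_Integration.integral_sum; intro sum.cong refl Bochner_Integration.integral_sum
        Bochner_Integration.integrable_sum Yint)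
  also have "\<dots> \<le> (\<Sum>i<m. \<Sum>j<m. Q\<^sup>2 * ((if j = i then real m else 0) +
      c * (sqrt 8 * sqrt m * (if j = i then 0 else 1 / sqrt \<bar>real i - real j\<bar>))))"
    by (intro sum_mono corr) auto
  also have "\<dots> = Q\<^sup>2 * (\<Sum>i<m. real m +
      c * (sqrt 8 * sqrt m * (\<Sum>j<m. if j = i then 0 else 1 / sqrt \<bar>real i - real j\<bar>)))"
    unfolding sum_distrib_left[symmetric] sum.distrib
    by (simp add: sum.delta)
  also have "\<dots> \<le> Q\<^sup>2 * (\<Sum>i<m. real m + c * (sqrt 8 * sqrt m * (4 * sqrt m)))"
    by (intro mult_left_mono sum_mono add_left_mono inverse_sqrt_dist_sum_le) (auto simp: c_def)
  also have "\<dots> \<le> Q\<^sup>2 * (\<Sum>i<m. real m + c * (3 * real m * 4))"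
  proof -
    have "sqrt 8 \<le> 3" by (rule real_le_lsqrt) auto
    then have "sqrt 8 * real m * 4 \<le> 3 * real m * 4" by (intro mult_right_mono) auto
    moreover have "sqrt 8 * sqrt m * (4 * sqrt m) = sqrt 8 * real m * 4" by simp
    ultimately have "sqrt 8 * sqrt m * (4 * sqrt m) \<le> 3 * real m * 4" by linarith
    then show ?thesis by (intro mult_left_mono sum_mono add_left_mono) (simp_all add: c_def)
  qed
  also have "\<dots> = C * (real m * Q)\<^sup>2" by (simp add: C_def power2_eq_square algebra_simps)
  finally have EX2: "expectation (\<lambda>\<omega>. (X \<omega>)\<^sup>2) \<le> C * (real m * Q)\<^sup>2" .
  have Xint: "integrable M X" unfolding X_def[abs_def] by (intro Bochner_Integration.integrable_sum Yint1)
  have X2int: "integrable M (\<lambda>\<omega>. (X \<omega>)\<^sup>2)"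
    unfolding X_def power2_eq_square sum_product by (intro Bochner_Integration.integrable_sum Yint)
  have EX: "expectation X = real m * Q"
    unfolding X_def[abs_def] by (subst Bochner_Integration.integral_sum) (auto intro: Yint1 simp: EY)
  let ?A = "{\<omega> \<in> space M. \<exists>i<m. 0 < Y i \<omega>}"
  have A: "?A \<in> events"
  proof -
    have "?A = (\<Union>i\<in>{..<m}. {\<omega> \<in> space M. 0 < Y i \<omega>})" by auto
    also have "\<dots> \<in> events" unfolding Y_def by (intro sets.finite_UN walk_pred_sets) auto
    finally show ?thesis .
  qed
  \<comment> \<open>The maximiser of \<open>2 * s * P - s^2 * C * P^2\<close> for
    \<open>P = m * Q\<close>; the maximum is \<open>1 / C\<close>.\<close>
  define s where "s = 1 / (C * (real m * Q))"
  have mQ: "real m * Q > 0" using m0 Q by simp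
  have s: "s \<ge> 0" using C mQ by (simp add: s_def)
  text \<open>The second moment method, linearised: \<open>1 - (1 - s X)\<^sup>2\<close> is at most 1, and 0 where \<open>X\<close> vanishes.\<close>
  have "1 / (C * P) * P = 1 / C" if "P > 0" for P :: real using C that by simp
  from this[OF mQ] have sP: "s * (real m * Q) = 1 / C" by (simp only: s_def)
  have "1 / C = 2 * (s * (real m * Q)) - C * (s * (real m * Q))\<^sup>2"
    unfolding sP using C by (simp add: power2_eq_square)
  also have "\<dots> = 2 * s * (real m * Q) - s\<^sup>2 * (C * (real m * Q)\<^sup>2)"
    by (simp only: power_mult_distrib mult_ac)
  also have "\<dots> \<le> 2 * s * expectation X - s\<^sup>2 * expectation (\<lambda>\<omega>. (X \<omega>)\<^sup>2)"
    unfolding EX by (intro diff_left_mono mult_left_mono EX2) auto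
  also have "\<dots> = expectation (\<lambda>\<omega>. 2 * s * X \<omega> - s\<^sup>2 * (X \<omega>)\<^sup>2)"
    using Xint X2int by simp
  also have "\<dots> \<le> expectation (indicat_real ?A)"
  proof (rule integral_mono)
    show "integrable M (\<lambda>\<omega>. 2 * s * X \<omega> - s\<^sup>2 * (X \<omega>)\<^sup>2)" using Xint X2int by simp
    show "integrable M (indicat_real ?A)" using A by (rule integrable_real_indicator) (simp add: emeasure_eq_measure)
    fix \<omega> assume \<omega>: "\<omega> \<in> space M"
    show "2 * s * X \<omega> - s\<^sup>2 * (X \<omega>)\<^sup>2 \<le> indicat_real ?A \<omega>"
    proof (cases "\<omega> \<in> ?A")
      case True
      have "0 \<le> (1 - s * X \<omega>)\<^sup>2" by simp
      then show ?thesis using True by (simp add: power2_eq_square algebra_simps)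
    next
      case False
      have "Y i \<omega> = 0" if "i < m" for i
      proof -
        have "\<not> 0 < Y i \<omega>" using False \<omega> that by blast
        moreover have "0 \<le> Y i \<omega>" unfolding Y_def using block_prod_range by blast
        ultimately show ?thesis by linarith
      qed
      then have "X \<omega> = 0" by (simp add: X_def)
      then show ?thesis by simp
    qed
  qed
  also have "\<dots> = prob (?A \<inter> space M)" by (rule Bochner_Integration.integral_indicator)
  also have "?A \<inter> space M = ?A" by blast
  finally show ?thesis unfolding C_def c_def Y_def by (rule that[OF m0])
qed

end

subsection \<open>Exceptional times\<close>

lemma in_parabola_step_list:
  "in_parabola j K n (step_list \<xi> n) \<longleftrightarrow>
    (\<forall>i\<le>n. \<bar>real_of_int (path_steps \<xi> (0, 0) i)\<bar> \<le> j + K * sqrt (real i))"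
  by (auto simp: in_parabola_def sum_take_step_list)

lemma in_parabola_step_list_antimono:
  "in_parabola j K n (step_list \<xi> n) \<Longrightarrow> m \<le> n \<Longrightarrow> in_parabola j K m (step_list \<xi> m)"
  by (auto simp: in_parabola_step_list)

lemma in_parabola_mono:
  assumes "in_parabola j K n as" "j \<le> j'" "K \<le> K'"
  shows "in_parabola j' K' n as"
proof -
  have "j + K * sqrt (real i) \<le> j' + K' * sqrt (real i)" for i
    using assms by (intro add_mono mult_right_mono) auto
  with assms(1) show ?thesis unfolding in_parabola_def by (meson order_trans)
qed

text \<open>Concavity of the square root on a unit interval, from the exact variance identity for a
  two-point average.\<close>

lemma sqrt_interpolate:
  assumes "0 \<le> s" "s \<le> 1" "0 \<le> x"
  shows "(1 - s) * sqrt x + s * sqrt (x + 1) \<le> sqrt (x + s)"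
proof (rule real_le_rsqrt)
  have "((1 - s) * sqrt x + s * sqrt (x + 1))\<^sup>2 =
      (1 - s) * x + s * (x + 1) - (s * (1 - s)) * (sqrt (x + 1) - sqrt x)\<^sup>2"
  proof -
    have "((1 - s) * a + s * b)\<^sup>2 = (1 - s) * a\<^sup>2 + s * b\<^sup>2 - (s * (1 - s)) * (b - a)\<^sup>2" for a b :: real
      by (simp add: power2_eq_square algebra_simps)
    moreover have "(sqrt x)\<^sup>2 = x" "(sqrt (x + 1))\<^sup>2 = x + 1" using assms by auto
    ultimately show ?thesis by metis
  qed
  also have "\<dots> \<le> (1 - s) * x + s * (x + 1)" using assms by simp
  finally show "((1 - s) * sqrt x + s * sqrt (x + 1))\<^sup>2 \<le> x + s" by (simp add: algebra_simps)
qed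

text \<open>The bound is concave in \<open>t\<close> for \<open>K \<ge> 0\<close>, so it lies above
  its chords, and integer times control the linear interpolation.\<close>

lemma arrow_path_parabola_iff:
  assumes K: "0 \<le> K"
  shows "(\<forall>t\<ge>0. \<bar>arrow_path \<xi> (0, 0) t\<bar> \<le> j + K * sqrt t) \<longleftrightarrow> (\<forall>n. in_parabola j K n (step_list \<xi> n))"
proof
  assume *: "\<forall>t\<ge>0. \<bar>arrow_path \<xi> (0, 0) t\<bar> \<le> j + K * sqrt t"
  have "\<bar>real_of_int (path_steps \<xi> (0, 0) i)\<bar> \<le> j + K * sqrt (real i)" for i
    using *[rule_format, of "real i"] by (simp add: arrow_path_def)
  then show "\<forall>n. in_parabola j K n (step_list \<xi> n)" by (simp add: in_parabola_step_list)
next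
  assume *: "\<forall>n. in_parabola j K n (step_list \<xi> n)"
  show "\<forall>t\<ge>0. \<bar>arrow_path \<xi> (0, 0) t\<bar> \<le> j + K * sqrt t"
  proof (intro allI impI)
    fix t :: real assume t: "0 \<le> t"
    define n where "n = nat \<lfloor>t\<rfloor>"
    define s where "s = t - real n"
    have s: "0 \<le> s" "s \<le> 1" using t unfolding s_def n_def by linarith+
    define p q where "p = real_of_int (path_steps \<xi> (0, 0) n)" and "q = real_of_int (path_steps \<xi> (0, 0) (Suc n))"
    have pq: "\<bar>p\<bar> \<le> j + K * sqrt n" "\<bar>q\<bar> \<le> j + K * sqrt (real n + 1)"
      using *[rule_format, of "Suc n"] unfolding in_parabola_step_list p_def q_def by (auto simp: add.commute)
    have "arrow_path \<xi> (0, 0) t = (1 - s) * p + s * q"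
      by (simp add: arrow_path_def Let_def n_def[symmetric] s_def p_def q_def algebra_simps del: path_steps.simps)
    also have "\<bar>\<dots>\<bar> \<le> (1 - s) * \<bar>p\<bar> + s * \<bar>q\<bar>"
      using s abs_triangle_ineq[of "(1 - s) * p" "s * q"] by (simp add: abs_mult)
    also have "\<dots> \<le> (1 - s) * (j + K * sqrt n) + s * (j + K * sqrt (real n + 1))"
      using s pq by (intro add_mono mult_left_mono) auto
    also have "\<dots> = j + K * ((1 - s) * sqrt n + s * sqrt (real n + 1))" by (simp add: algebra_simps)
    also have "\<dots> \<le> j + K * sqrt (real n + s)"
      using s K by (intro add_left_mono mult_left_mono sqrt_interpolate) auto
    finally show "\<bar>arrow_path \<xi> (0, 0) t\<bar> \<le> j + K * sqrt t" by (simp add: s_def)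
  qed
qed

text \<open>The limiting path meets only finitely many sites, and agreement on these already forces
  the same path.\<close>

lemma eventually_step_list_eq:
  assumes "\<And>z. z \<in> Z2_even \<Longrightarrow> \<forall>\<^sub>F s in F. \<xi> s z = \<eta> z" and \<eta>: "\<And>z. z \<in> Z2_even \<Longrightarrow> \<eta> z \<in> {-1,1}"
  shows "\<forall>\<^sub>F s in F. step_list (\<xi> s) n = step_list \<eta> n"
proof -
  let ?as = "step_list \<eta> n"
  have "(sum_list (take i ?as), int i) \<in> Z2_even" if "i < n" for i
    using that by (intro sum_list_even_site step_list_range \<eta>) auto
  then have "\<forall>\<^sub>F s in F. \<forall>i\<in>{..<n}. \<xi> s (sum_list (take i ?as), int i) = \<eta> (sum_list (take i ?as), int i)"
    using assms(1) by (intro eventually_ball_finite) auto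
  moreover have "\<forall>i<n. \<eta> (sum_list (take i ?as), int i) = ?as ! i"
    using step_list_eq_iff[of \<eta> n ?as] by simp
  ultimately show ?thesis
    by (elim eventually_mono) (auto simp: step_list_eq_iff[of _ n ?as])
qed

section \<open>One-sided limits in dynamical time and the passage to infinite paths\<close>

context dynamical_discrete_web
begin

text \<open>The strict inequality makes this the left limit of \<open>num_rings\<close>.\<close>

definition rings_before :: "int \<times> int \<Rightarrow> real \<Rightarrow> 'a \<Rightarrow> nat" where
  "rings_before z \<tau> \<omega> = card {n. ring_time gap z n \<omega> < \<tau>}"

lemma num_rings_right:
  assumes "regular_clock z \<omega>"
  shows "\<forall>\<^sub>F s in at_right \<tau>. num_rings gap z s \<omega> = num_rings gap z \<tau> \<omega>"
proof -
  let ?r = "\<lambda>n. ring_time gap z n \<omega>"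
  have fin: "finite {n. ?r n \<le> \<tau> + 1}" using assms by (simp add: regular_clock_def)
  have "\<forall>\<^sub>F s in at_right \<tau>. \<forall>n\<in>{n. ?r n \<le> \<tau> + 1}. \<tau> < ?r n \<longrightarrow> s < ?r n"
  proof (intro eventually_ball_finite fin ballI)
    fix n
    show "\<forall>\<^sub>F s in at_right \<tau>. \<tau> < ?r n \<longrightarrow> s < ?r n"
    proof (cases "\<tau> < ?r n")
      case True
      from eventually_at_right_real[OF this] show ?thesis by (rule eventually_mono) auto
    qed simp
  qed
  moreover have "\<forall>\<^sub>F s in at_right \<tau>. s \<in> {\<tau><..<\<tau> + 1}" by (rule eventually_at_right_real) simp
  ultimately show ?thesis
  proof eventually_elim
    case (elim s)
    then have "{n. ?r n \<le> s} = {n. ?r n \<le> \<tau>}" by (auto simp: not_less[symmetric]) (force simp: not_less)+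
    then show ?case by (simp add: num_rings_def)
  qed
qed

lemma num_rings_left:
  assumes "regular_clock z \<omega>"
  shows "\<forall>\<^sub>F s in at_left \<tau>. num_rings gap z s \<omega> = rings_before z \<tau> \<omega>"
proof -
  let ?r = "\<lambda>n. ring_time gap z n \<omega>"
  have fin: "finite {n. ?r n \<le> \<tau>}" using assms by (simp add: regular_clock_def)
  have "\<forall>\<^sub>F s in at_left \<tau>. \<forall>n\<in>{n. ?r n \<le> \<tau>}. ?r n < \<tau> \<longrightarrow> ?r n < s"
  proof (intro eventually_ball_finite fin ballI)
    fix n
    show "\<forall>\<^sub>F s in at_left \<tau>. ?r n < \<tau> \<longrightarrow> ?r n < s"
    proof (cases "?r n < \<tau>")
      case True
      from eventually_at_left_real[OF this] show ?thesis by (rule eventually_mono) auto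
    qed simp
  qed
  moreover have "\<forall>\<^sub>F s in at_left \<tau>. s \<in> {\<tau> - 1<..<\<tau>}" by (rule eventually_at_left_real) simp
  ultimately show ?thesis
  proof eventually_elim
    case (elim s)
    then have "{n. ?r n \<le> s} = {n. ?r n < \<tau>}" by force
    then show ?case by (simp add: num_rings_def rings_before_def)
  qed
qed

definition left_walk :: "nat \<Rightarrow> real \<Rightarrow> 'a \<Rightarrow> int list" where
  "left_walk n \<tau> \<omega> = step_list (\<lambda>z. val z (rings_before z \<tau> \<omega>) \<omega>) n"

lemma walk_right:
  assumes "\<omega> \<in> space M" "\<And>z. z \<in> Z2_even \<Longrightarrow> regular_clock z \<omega>"
  shows "\<forall>\<^sub>F s in at_right \<tau>. walk n s \<omega> = walk n \<tau> \<omega>"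
proof (rule eventually_step_list_eq)
  show "\<forall>\<^sub>F s in at_right \<tau>. arrow gap val z s \<omega> = arrow gap val z \<tau> \<omega>" if "z \<in> Z2_even" for z
    using num_rings_right[OF assms(2)[OF that], of \<tau>] by (rule eventually_mono) (simp add: arrow_def)
qed (rule arrow_range[OF _ assms(1)])

lemma walk_left:
  assumes "\<omega> \<in> space M" "\<And>z. z \<in> Z2_even \<Longrightarrow> regular_clock z \<omega>"
  shows "\<forall>\<^sub>F s in at_left \<tau>. walk n s \<omega> = left_walk n \<tau> \<omega>"
  unfolding left_walk_def
proof (rule eventually_step_list_eq)
  show "\<forall>\<^sub>F s in at_left \<tau>. arrow gap val z s \<omega> = val z (rings_before z \<tau> \<omega>) \<omega>" if "z \<in> Z2_even" for z
    using num_rings_left[OF assms(2)[OF that], of \<tau>] by (rule eventually_mono) (simp add: arrow_def)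
qed (rule val_range[OF _ assms(1)])

text \<open>A ring time is a function of the clocks, hence so are all indices
  \<open>rings_before\<close> at that time. Given the clocks the values are still fair and
  independent, so the left walk is a simple random walk.\<close>

lemma AE_left_walk_exits:
  assumes z0: "z0 \<in> Z2_even" and "0 \<le> j" "0 \<le> K"
  shows "AE \<omega> in M. \<exists>n. \<not> in_parabola j K n (left_walk n (ring_time gap z0 k \<omega>) \<omega>)"
proof -
  let ?\<tau> = "\<lambda>\<omega>. ring_time gap z0 k \<omega>"
  have N: "(\<lambda>\<omega>. rings_before z (?\<tau> \<omega>) \<omega>) \<in> measurable gap_alg (count_space UNIV)" if z: "z \<in> Z2_even" for z
  proof -
    have [measurable]: "gap z n \<in> borel_measurable gap_alg" "gap z0 n \<in> borel_measurable gap_alg" for n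
      unfolding gap_alg_def using z z0 by (auto intro!: gap_measurable_alg)
    show ?thesis unfolding rings_before_def ring_time_def by measurable
  qed
  let ?A = "\<lambda>n. {\<omega> \<in> space M. in_parabola j K n (left_walk n (?\<tau> \<omega>) \<omega>)}"
  have A: "?A n \<in> events" for n
    unfolding left_walk_def by (rule step_list_pred) (auto intro: val_index_measurable[OF N] dest: val_range)
  have PA: "prob (?A n) = walk_avg n (\<lambda>as. of_bool (in_parabola j K n as))" for n
    unfolding left_walk_def by (rule prob_step_list_pred[OF N])
  have Int: "(\<Inter>n. ?A n) \<in> events" using A by (intro sets.countable_INT) auto
  have "prob (\<Inter>n. ?A n) = 0"
  proof (rule ccontr)
    assume "prob (\<Inter>n. ?A n) \<noteq> 0"
    then have "0 < prob (\<Inter>n. ?A n)" by (simp add: less_le)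
    from walk_avg_in_parabola[OF assms(2,3) this] obtain n where
      "walk_avg n (\<lambda>as. of_bool (in_parabola j K n as)) < prob (\<Inter>n. ?A n)" .
    moreover have "prob (\<Inter>n. ?A n) \<le> prob (?A n)" by (rule finite_measure_mono[OF _ A]) auto
    ultimately show False by (simp add: PA)
  qed
  then have "AE \<omega> in M. \<omega> \<notin> (\<Inter>n. ?A n)" using Int by (simp only: prob_eq_0)
  then show ?thesis by (rule AE_mp) (rule AE_I2, auto)
qed

definition exceptional :: "real \<Rightarrow> real \<Rightarrow> 'a set" where
  "exceptional j K = {\<omega> \<in> space M. \<exists>\<tau>\<in>{0..1}. \<forall>n. in_parabola j K n (walk n \<tau> \<omega>)}"

text \<open>Rational times keep this a countable union of events; by right-continuity, paths of
  finite length see almost surely no difference.\<close>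

definition exceptional_upto :: "real \<Rightarrow> real \<Rightarrow> nat \<Rightarrow> 'a set" where
  "exceptional_upto j K n = {\<omega> \<in> space M. \<exists>\<tau>\<in>\<rat> \<inter> {0..1}. in_parabola j K n (walk n \<tau> \<omega>)}"

lemma exceptional_upto_sets: "exceptional_upto j K n \<in> events"
proof -
  have "exceptional_upto j K n = (\<Union>\<tau>\<in>\<rat> \<inter> {0..1}. {\<omega> \<in> space M. in_parabola j K n (walk n \<tau> \<omega>)})"
    by (auto simp: exceptional_upto_def)
  also have "\<dots> \<in> events"
    using countable_rat by (intro sets.countable_UN') (auto intro: walk_pred_sets[where P = "in_parabola j K n"])
  finally show ?thesis .
qed

text \<open>Goodness up to level \<open>n\<close> is a right-continuous condition, so that a limit of good times can only
  fail to be good if it is approached from the left and is the time of a ring. But the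
  environment seen just before a ring is a plain discrete web, whose path leaves every parabola.\<close>

lemma exceptional_iff_AE:
  assumes "0 \<le> j" "0 \<le> K"
  shows "AE \<omega> in M. \<omega> \<in> exceptional j K \<longleftrightarrow> (\<forall>n. \<omega> \<in> exceptional_upto j K n)"
proof -
  have "AE \<omega> in M. \<forall>z\<in>Z2_even. regular_clock z \<omega>"
    by (intro AE_ball_countable' AE_regular_clock) auto
  moreover have "AE \<omega> in M. \<forall>z\<in>Z2_even. \<forall>k. \<exists>n. \<not> in_parabola j K n (left_walk n (ring_time gap z k \<omega>) \<omega>)"
    using AE_left_walk_exits assms by (intro AE_ball_countable') (auto simp: AE_all_countable)
  ultimately show ?thesis using AE_space
  proof eventually_elim
    case (elim \<omega>)
    then have \<omega>: "\<omega> \<in> space M" and reg: "\<And>z. z \<in> Z2_even \<Longrightarrow> regular_clock z \<omega>" by auto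
    let ?ok = "\<lambda>n \<tau>. in_parabola j K n (walk n \<tau> \<omega>)"
    show ?case
    proof
      assume "\<omega> \<in> exceptional j K"
      then obtain \<tau> where \<tau>: "0 \<le> \<tau>" "\<tau> \<le> 1" "\<And>n. ?ok n \<tau>" by (auto simp: exceptional_def)
      show "\<forall>n. \<omega> \<in> exceptional_upto j K n"
      proof
        fix n
        have "\<exists>q\<in>\<rat> \<inter> {0..1}. ?ok n q"
        \<comment> \<open>A nearby rational time must be taken to the right of \<tau>; at the end
          point this is impossible, but 1 is itself rational.\<close>
        proof (cases "\<tau> = 1")
          case True
          then show ?thesis using \<tau>(3)[of n] by (intro bexI[of _ 1]) auto
        next
          case False
          obtain b where b: "\<tau> < b" "\<And>s. \<tau> < s \<Longrightarrow> s < b \<Longrightarrow> walk n s \<omega> = walk n \<tau> \<omega>"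
            using walk_right[OF \<omega> reg, of n \<tau>] unfolding eventually_at_right[OF less_add_one] by blast
          obtain q where q: "q \<in> \<rat>" "\<tau> < q" "q < min b 1"
            using Rats_dense_in_real[of \<tau> "min b 1"] b(1) False \<tau> by auto
          then have "?ok n q" using b(2)[of q] \<tau>(3)[of n] by simp
          then show ?thesis using q \<tau> by (intro bexI[of _ q]) auto
        qed
        then show "\<omega> \<in> exceptional_upto j K n" using \<omega> by (auto simp: exceptional_upto_def)
      qed
    next
      assume upto: "\<forall>n. \<omega> \<in> exceptional_upto j K n"
      show "\<omega> \<in> exceptional j K"
      proof (rule ccontr)
        assume not: "\<omega> \<notin> exceptional j K"
        from upto have "\<forall>n. \<exists>\<tau>. \<tau> \<in> {0..1} \<and> ?ok n \<tau>"
          unfolding exceptional_upto_def by blast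
        then obtain T where T: "\<And>n. T n \<in> {0..1}" "\<And>n. ?ok n (T n)" by metis
        obtain \<tau> r where \<tau>: "\<tau> \<in> {0..1}" "strict_mono r" "(T \<circ> r) \<longlonglongrightarrow> \<tau>"
          using T(1) compact_Icc[of 0 "1::real"] unfolding compact_def by metis
        obtain n1 where n1: "\<not> ?ok n1 \<tau>" using not \<omega> \<tau>(1) unfolding exceptional_def by blast
        \<comment> \<open>At a ring time this is the almost sure exit of the left walk; at any other
          time the left environment is the one at \<tau>, which fails at level
          \<open>n1\<close>.\<close>
        obtain n2 where n2: "\<not> in_parabola j K n2 (left_walk n2 \<tau> \<omega>)"
        proof (cases "\<exists>z\<in>Z2_even. \<exists>k. ring_time gap z k \<omega> = \<tau>")
          case True
          with elim that show ?thesis by blast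
        next
          case False
          have "arrow gap val z \<tau> \<omega> = val z (rings_before z \<tau> \<omega>) \<omega>" if "z \<in> Z2_even" for z
          proof -
            have "{n. ring_time gap z n \<omega> \<le> \<tau>} = {n. ring_time gap z n \<omega> < \<tau>}"
              using False that by (auto simp: le_less)
            then show ?thesis by (simp add: arrow_def num_rings_def rings_before_def)
          qed
          \<comment> \<open>A constant family over a one-point filter: plain equality of the two
            walks, from agreement at even sites alone.\<close>
          then have "\<forall>\<^sub>F s in (top :: unit filter). step_list (\<lambda>z. val z (rings_before z \<tau> \<omega>) \<omega>) n1 = walk n1 \<tau> \<omega>"
            by (intro eventually_step_list_eq[where \<xi> = "\<lambda>_ z. val z (rings_before z \<tau> \<omega>) \<omega>"] arrow_range[OF _ \<omega>]) auto
          then have "left_walk n1 \<tau> \<omega> = walk n1 \<tau> \<omega>" by (simp add: left_walk_def)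
          with n1 have "\<not> in_parabola j K n1 (left_walk n1 \<tau> \<omega>)" by simp
          then show ?thesis by (rule that)
        qed
        define n where "n = max n1 n2"
        have n: "\<not> ?ok n \<tau>" "\<not> in_parabola j K n (left_walk n \<tau> \<omega>)"
          using n1 n2 in_parabola_step_list_antimono[of j K n] by (auto simp: n_def left_walk_def)
        have "\<forall>\<^sub>F s in at_right \<tau>. \<not> ?ok n s"
          using walk_right[OF \<omega> reg, of n \<tau>] n(1) by (auto elim: eventually_mono)
        moreover have "\<forall>\<^sub>F s in at_left \<tau>. \<not> ?ok n s"
          using walk_left[OF \<omega> reg, of n \<tau>] n(2) by (auto elim: eventually_mono)
        \<comment> \<open>Level \<open>n\<close> fails on a whole neighbourhood of \<tau>, although
          \<open>T (r i)\<close> enters it and is good up to level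
          \<open>r i \<ge> n\<close>.\<close>
        ultimately have "\<forall>\<^sub>F s in nhds \<tau>. \<not> ?ok n s"
          using n(1) by (simp add: eventually_nhds_conv_at eventually_at_split)
        from eventually_compose_filterlim[OF this \<tau>(3)]
        have "\<forall>\<^sub>F i in sequentially. \<not> ?ok n ((T \<circ> r) i)" .
        then have "\<forall>\<^sub>F i in sequentially. \<not> ?ok n (T (r i)) \<and> n \<le> i"
          by (simp add: eventually_conj_iff eventually_ge_at_top)
        then obtain i where i: "\<not> ?ok n (T (r i))" "n \<le> i" by (auto simp: eventually_sequentially)
        have "n \<le> r i" using i(2) seq_suble[OF \<tau>(2), of i] by simp
        with T(2)[of "r i"] i(1) show False using in_parabola_step_list_antimono by blast
      qed
    qed
  qed
qed

lemma prob_exceptional_upto: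
  assumes "4 \<le> j" "32 \<le> K"
  shows "1 / (1 + 12 * exp 40) \<le> prob (exceptional_upto j K n)"
proof -
  obtain m where m: "m > 0"
    "1 / (1 + 12 * exp 40) \<le> prob {\<omega> \<in> space M. \<exists>i<m. 0 < block_prod n 0 (walk (block_len n 0) (real i / real m) \<omega>)}"
    by (rule prob_exceptional_grid)
  have len: "n \<le> block_len n k" for k
  proof (induction n arbitrary: k)
    case (Suc n)
    have "1 \<le> (64 :: nat) ^ k" by simp
    with Suc[of "Suc k"] show ?case unfolding block_len.simps by linarith
  qed simp
  have "{\<omega> \<in> space M. \<exists>i<m. 0 < block_prod n 0 (walk (block_len n 0) (real i / real m) \<omega>)} \<subseteq> exceptional_upto j K n"
  proof safe
    fix \<omega> i assume \<omega>: "\<omega> \<in> space M" and i: "i < m" and pos: "0 < block_prod n 0 (walk (block_len n 0) (real i / real m) \<omega>)"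
    have "in_parabola 4 32 (block_len n 0) (walk (block_len n 0) (real i / real m) \<omega>)"
      unfolding in_parabola_def
      using block_prod_pos_bound[OF pos, of 0] by auto
    then have "in_parabola j K (block_len n 0) (walk (block_len n 0) (real i / real m) \<omega>)"
      by (rule in_parabola_mono) (use assms in auto)
    then have "in_parabola j K n (walk n (real i / real m) \<omega>)"
      by (rule in_parabola_step_list_antimono) (rule len)
    moreover have "real i / real m \<in> \<rat> \<inter> {0..1}" using i by auto
    ultimately show "\<omega> \<in> exceptional_upto j K n" using \<omega> by (auto simp: exceptional_upto_def)
  qed
  then have "prob {\<omega> \<in> space M. \<exists>i<m. 0 < block_prod n 0 (walk (block_len n 0) (real i / real m) \<omega>)} \<le>
      prob (exceptional_upto j K n)"
    by (rule finite_measure_mono) (rule exceptional_upto_sets)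
  with m(2) show ?thesis by simp
qed

text \<open>The events \<open>exceptional_upto j K n\<close> decrease in \<open>n\<close>, so the
  uniform bound passes to their intersection. The exceptional event differs from it within a null
  set, which gives measurability in the completion and equal measure.\<close>

lemma measure_exceptional_pos:
  assumes "4 \<le> j" "32 \<le> K"
  shows "0 < measure (completion M) (exceptional j K)"
proof -
  let ?E = "\<Inter>n. exceptional_upto j K n"
  have E: "?E \<in> events" using exceptional_upto_sets by (intro sets.countable_INT) auto
  have "decseq (exceptional_upto j K)"
    unfolding decseq_def exceptional_upto_def using in_parabola_step_list_antimono by blast
  then have "(\<lambda>n. prob (exceptional_upto j K n)) \<longlonglongrightarrow> prob ?E"
    using exceptional_upto_sets by (intro finite_Lim_measure_decseq) auto
  then have "1 / (1 + 12 * exp 40) \<le> prob ?E"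
    by (rule LIMSEQ_le_const) (use prob_exceptional_upto[OF assms] in auto)
  moreover have "0 < 1 / (1 + 12 * exp 40 :: real)" by (simp add: add_pos_pos)
  ultimately have pos: "0 < prob ?E" by linarith
  have "AE \<omega> in M. \<omega> \<in> exceptional j K \<longleftrightarrow> \<omega> \<in> ?E"
    using exceptional_iff_AE[of j K] assms by simp
  then obtain N where N: "N \<in> null_sets M" "{\<omega> \<in> space M. \<not> (\<omega> \<in> exceptional j K \<longleftrightarrow> \<omega> \<in> ?E)} \<subseteq> N"
    by (auto simp: eventually_ae_filter)
  have "exceptional j K = (?E - N) \<union> (exceptional j K \<inter> N)"
  proof -
    have "exceptional j K \<subseteq> space M" "?E \<subseteq> space M" by (auto simp: exceptional_def exceptional_upto_def)
    with N(2) show ?thesis by blast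
  qed
  then have "exceptional j K \<in> sets (completion M)"
    using E N(1) by (intro sets_completionI[of _ "?E - N" "exceptional j K \<inter> N" N]) auto
  moreover have "?E \<in> sets (completion M)" using E by (rule sets_completionI_sets)
  moreover have "AE \<omega> in completion M. \<omega> \<in> exceptional j K \<longleftrightarrow> \<omega> \<in> ?E"
    using \<open>AE \<omega> in M. _\<close> by (rule AE_completion)
  ultimately have "measure (completion M) (exceptional j K) = measure (completion M) ?E"
    by (intro measure_eq_AE) auto
  also have "\<dots> = prob ?E" using E by simp
  finally show ?thesis using pos by simp
qed

end

(* The event is an uncountable union over tau, so its probability is taken in the completion
   of M; since measure is 0 on non-measurable sets, positivity includes measurability there. *)
theorem theorem1:
  fixes M :: "'a measure"
    and gap :: "int \<times> int \<Rightarrow> nat \<Rightarrow> 'a \<Rightarrow> real"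
    and val :: "int \<times> int \<Rightarrow> nat \<Rightarrow> 'a \<Rightarrow> int"
  assumes "dynamical_discrete_web M gap val"
  shows "\<exists>K0 j0 :: real. \<forall>K\<ge>K0. \<forall>j\<ge>j0.
    measure (completion M)
      {\<omega> \<in> space M. \<exists>\<tau>\<in>{0..1}. \<forall>t\<ge>0.
        \<bar>dydw_path gap val (0, 0) \<tau> \<omega> t\<bar> \<le> j + K * sqrt t} > 0"
proof -
  interpret dynamical_discrete_web M gap val by (rule assms)
  have "measure (completion M) {\<omega> \<in> space M. \<exists>\<tau>\<in>{0..1}. \<forall>t\<ge>0.
      \<bar>dydw_path gap val (0, 0) \<tau> \<omega> t\<bar> \<le> j + K * sqrt t} > 0" if "32 \<le> K" "4 \<le> j" for j K :: real
    using measure_exceptional_pos[OF that(2,1)] that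
    by (simp add: exceptional_def dydw_path_def arrow_path_parabola_iff)
  then show ?thesis by blast
qed

end
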